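(* Let $X^{s}$ be a generic symmetric $2n\times 2n$ matrix. Then the apolar ideal $\mathrm{Ann}(Hf(X^{s}))$ is generated in degree 2, and $$2^{2n-2}\le cr(Hf(X^s))\le 2^{2n-1}.$$
   Context: Let $\mathsf k$ be a field of characteristic zero or of characteristic $p>2$. Let $X^s=(x_{ij})$ be a generic symmetric $2n\times 2n$ matrix, that is, $x_{ij}=x_{ji}$ and the entries $x_{ij}$, $1\le i\le j\le 2n$, are independent variables. Let $R=\mathsf k[x_{ij}: i\le j]$ and $S=\mathsf k[y_{ij}: i\le j]$ with the standard grading. $S$ acts on $R$ by contraction: $\prod y_{ij}^{\alpha_{ij}}\circ\prod x_{ij}^{\beta_{ij}}=\prod x_{ij}^{\beta_{ij}-\alpha_{ij}}$ if $\alpha_{ij}\le\beta_{ij}$ for all $i\le j$, and $0$ otherwise, extended $\mathsf k$-bilinearly. For a homogeneous $F\in R$, the apolar ideal is $\mathrm{Ann}(F)=\{\Phi\in S:\Phi\circ F=0\}$. The Hafnian is $Hf(X^{s})=\sum_{\sigma\in F_{2n}}x_{\sigma(1)\sigma(2)}x_{\sigma(3)\sigma(4)}\cdots x_{\sigma(2n-1)\sigma(2n)}$, where $F_{2n}$ is the set of permutations $\sigma$ of $\{1,\dots,2n\}$ with $\sigma(1)<\sigma(3)<\dots<\sigma(2n-1)$ and $\sigma(2i-1)<\sigma(2i)$ for all $1\le i\le n$. $S$ is regarded as the homogeneous coordinate ring of the projective space $\mathbf P(R_1)$ of 1-dimensional subspaces of $R_1$; for a zero-dimensional closed subscheme $\Gamma\subset\mathbf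 P(R_1)$, $I_\Gamma\subset S$ is its homogeneous ideal and $\deg\Gamma$ its length (number of points counted with multiplicity). The cactus rank is $cr(F)=\min\{\deg\Gamma:\Gamma\subset\mathbf P(R_1),\ \dim\Gamma=0,\ I_\Gamma\subset\mathrm{Ann}(F)\}$.
   Formalization: Since no diagonal x_ii occurs in the Hafnian, the linear forms y_ii lie in Ann(Hf), so it is not generated in degree 2 in k[y_ij : i≤j]; what is proved is that Ann(Hf) is generated by the y_ii together with its elements of degree 2. *)

theory Defs
  imports
    "HOL-Library.Poly_Mapping"
    "HOL-Combinatorics.Permutations"
    "HOL-Computational_Algebra.Computational_Algebra"
    "HOL-Algebra.Ideal"
begin

text \<open>
  Polynomials are finitely supported functions from exponent vectors to coefficients. The variables
  are indexed by pairs of natural numbers, and a polynomial ring is cut out by its set of variables.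
  The ring acting by contraction (variables \<open>y\<close>) and the ring acted upon (variables \<open>x\<close>) are two
  copies of the same ring and share one type.
\<close>

type_synonym monom = "(nat \<times> nat) \<Rightarrow>\<^sub>0 nat"
type_synonym 'k mpoly = "monom \<Rightarrow>\<^sub>0 'k"

definition var :: "nat \<times> nat \<Rightarrow> 'k::field mpoly" where
  "var v = Poly_Mapping.single (Poly_Mapping.single v 1) 1"

definition poly_ring :: "(nat \<times> nat) set \<Rightarrow> 'k::field mpoly ring" where
  "poly_ring V =
     \<lparr>carrier = {f. \<forall>m \<in> Poly_Mapping.keys f. Poly_Mapping.keys m \<subseteq> V},
      monoid.mult = (*), one = 1, ring.zero = 0, add = (+)\<rparr>"

definition monom_degree :: "monom \<Rightarrow> nat" where
  "monom_degree m = (\<Sum>v \<in> Poly_Mapping.keys m. Poly_Mapping.lookup m v)"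

definition homogeneous :: "nat \<Rightarrow> 'k::field mpoly \<Rightarrow> bool" where
  "homogeneous d f \<longleftrightarrow> (\<forall>m \<in> Poly_Mapping.keys f. monom_degree m = d)"

definition scalar_mult :: "'k::field \<Rightarrow> 'k mpoly \<Rightarrow> 'k mpoly" where
  "scalar_mult c f = Poly_Mapping.single 0 c * f"


definition contract :: "'k::field mpoly \<Rightarrow> 'k mpoly \<Rightarrow> 'k mpoly" where
  "contract \<Phi> F =
     (\<Sum>a \<in> Poly_Mapping.keys \<Phi>. \<Sum>b \<in> Poly_Mapping.keys F.
        if \<forall>v. Poly_Mapping.lookup a v \<le> Poly_Mapping.lookup b v
        then Poly_Mapping.single (b - a) (Poly_Mapping.lookup \<Phi> a * Poly_Mapping.lookup F b)
        else 0)"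

definition apolar_ideal :: "(nat \<times> nat) set \<Rightarrow> 'k::field mpoly \<Rightarrow> 'k mpoly set" where
  "apolar_ideal V F = {\<Phi> \<in> carrier (poly_ring V). contract \<Phi> F = 0}"


text \<open>
  A closed subscheme \<open>\<Gamma>\<close> of the projective space with homogeneous coordinate ring
  \<open>S = poly_ring V\<close> is represented by its homogeneous ideal \<open>I\<^sub>\<Gamma>\<close>. The ideals arising in this way
  are exactly the homogeneous ideals \<open>I\<close> that are saturated, \<open>I : S\<^sub>+ = I\<close>; the correspondence
  is one-to-one.
\<close>

definition homogeneous_ideal :: "(nat \<times> nat) set \<Rightarrow> 'k::field mpoly set \<Rightarrow> bool" where
  "homogeneous_ideal V I \<longleftrightarrow>
     ideal I (poly_ring V) \<and> I = Idl\<^bsub>poly_ring V\<^esub> {f \<in> I. \<exists>d. homogeneous d f}"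

definition saturated :: "(nat \<times> nat) set \<Rightarrow> 'k::field mpoly set \<Rightarrow> bool" where
  "saturated V I \<longleftrightarrow>
     (\<forall>f \<in> carrier (poly_ring V). (\<forall>v \<in> V. var v * f \<in> I) \<longrightarrow> f \<in> I)"

definition closed_subscheme_ideal :: "(nat \<times> nat) set \<Rightarrow> 'k::field mpoly set \<Rightarrow> bool" where
  "closed_subscheme_ideal V I \<longleftrightarrow> homogeneous_ideal V I \<and> saturated V I"

text \<open>The points of the subscheme, as points of \<open>Proj S\<close>.\<close>

definition support :: "(nat \<times> nat) set \<Rightarrow> 'k::field mpoly set \<Rightarrow> 'k mpoly set set" where
  "support V I =
     {P. homogeneous_ideal V P \<and> primeideal P (poly_ring V) \<and> I \<subseteq> P \<and> (\<exists>v \<in> V. var v \<notin> P)}"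

text \<open>
  Krull dimension zero: the subscheme is nonempty and no point properly specializes to another.
\<close>

definition zero_dimensional :: "(nat \<times> nat) set \<Rightarrow> 'k::field mpoly set \<Rightarrow> bool" where
  "zero_dimensional V I \<longleftrightarrow>
     support V I \<noteq> {} \<and> (\<forall>P \<in> support V I. \<forall>Q \<in> support V I. P \<subseteq> Q \<longrightarrow> P = Q)"

text \<open>The dimension of the degree \<open>t\<close> part of \<open>S / I\<close> over the ground field, for \<open>V\<close> finite.\<close>

definition hilbert_function :: "(nat \<times> nat) set \<Rightarrow> 'k::field mpoly set \<Rightarrow> nat \<Rightarrow> nat" where
  "hilbert_function V I t =
     vector_space.dim scalar_mult {f :: 'k mpoly. f \<in> carrier (poly_ring V) \<and> homogeneous t f}
     - vector_space.dim scalar_mult {f \<in> I. homogeneous t f}"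

text \<open>
  The Hilbert polynomial of a zero-dimensional \<open>\<Gamma>\<close> is the constant \<open>deg \<Gamma>\<close>, which is the dimension
  of \<open>\<O>\<^sub>\<Gamma>(\<Gamma>)\<close> over the ground field; so each point counts with its multiplicity times the degree
  of its residue field.
\<close>

definition has_degree :: "(nat \<times> nat) set \<Rightarrow> 'k::field mpoly set \<Rightarrow> nat \<Rightarrow> bool" where
  "has_degree V I d \<longleftrightarrow> (\<forall>\<^sub>F t in sequentially. hilbert_function V I t = d)"

definition cactus_rank :: "(nat \<times> nat) set \<Rightarrow> 'k::field mpoly \<Rightarrow> nat" where
  "cactus_rank V F =
     (LEAST d. \<exists>I. closed_subscheme_ideal V I \<and> zero_dimensional V I \<and> has_degree V I d
                   \<and> I \<subseteq> apolar_ideal V F)"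


definition sym_vars :: "nat \<Rightarrow> (nat \<times> nat) set" where
  "sym_vars n = {(i, j). 1 \<le> i \<and> i \<le> j \<and> j \<le> 2 * n}"

definition sym_entry :: "nat \<Rightarrow> nat \<Rightarrow> 'k::field mpoly" where
  "sym_entry i j = var (min i j, max i j)"

definition hafnian_perms :: "nat \<Rightarrow> (nat \<Rightarrow> nat) set" where
  "hafnian_perms n =
     {\<sigma>. \<sigma> permutes {1..2 * n}
         \<and> (\<forall>i \<in> {1..<n}. \<sigma> (2 * i - 1) < \<sigma> (2 * i + 1))
         \<and> (\<forall>i \<in> {1..n}. \<sigma> (2 * i - 1) < \<sigma> (2 * i))}"

definition hafnian :: "nat \<Rightarrow> 'k::field mpoly" where
  "hafnian n = (\<Sum>\<sigma> \<in> hafnian_perms n. \<Prod>i = 1..n. sym_entry (\<sigma> (2 * i - 1)) (\<sigma> (2 * i)))"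

text \<open>
  No diagonal entry of the matrix occurs in the Hafnian, so the linear forms \<open>y\<^sub>i\<^sub>i\<close> always lie in
  its apolar ideal, which therefore cannot be generated by quadrics alone in the ring on all
  \<open>y\<^sub>i\<^sub>j\<close>, \<open>i \<le> j\<close>. ``Generated in degree 2'' is read as: generated by these linear forms, which only
  remove the variables that do not occur, together with the elements of degree 2.
\<close>

definition diagonal_vars :: "nat \<Rightarrow> 'k::field mpoly set" where
  "diagonal_vars n = {var (i, i) | i. i \<in> {1..2 * n}}"

definition generated_in_degree_modulo ::
    "(nat \<times> nat) set \<Rightarrow> 'k::field mpoly set \<Rightarrow> nat \<Rightarrow> 'k mpoly set \<Rightarrow> bool" where
  "generated_in_degree_modulo V L d J \<longleftrightarrow>
     J = Idl\<^bsub>poly_ring V\<^esub> (L \<union> {\<Phi> \<in> J. homogeneous d \<Phi>})"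

end

theory Submission
  imports Defs
begin

text \<open>
  Give the edge variable \<open>(i, j)\<close> the multidegree \<open>e\<^sub>i + e\<^sub>j\<close>. The Hafnian is the sum of all monomials
  of multidegree \<open>(1, \<dots>, 1)\<close>, so the contraction of the Hafnian by a monomial depends only on the
  multidegree \<open>u\<close> of that monomial; it vanishes unless \<open>u\<close> is the indicator of a set of vertices,
  and distinct sets give linearly independent contractions. So the quotient by the apolar ideal has one
  basis element for every even subset of \<open>{1, \<dots>, 2n}\<close> and length \<open>2\<^bsup>2n-1\<^esup>\<close>. Two monomials with the
  same indicator multidegree are two matchings of the same set, which are connected by switching
  two edges at a time; hence the quadrics generate.

  For the lower bound, all squares of variables are apolar to the Hafnian, so a general combination of
  them is a nonzerodivisor \<open>g\<close> modulo the ideal \<open>I\<close> of a scheme \<open>\<Gamma>\<close>, and \<open>S / (I + (g))\<close>, of length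
  \<open>2 deg \<Gamma>\<close>, surjects onto the quotient by the apolar ideal. Over a finite field the general
  combination is replaced by one with the powers of a new variable as coefficients, which is a
  nonzerodivisor by McCoy's theorem.

  For the upper bound, \<open>I\<close> is the intersection of the apolar ideals of \<open>x\<^sub>1\<^sub>1\<^sup>j Hf\<close> over all \<open>j\<close>. It is the
  ideal of a scheme supported at one point, and its Hilbert function is eventually the number of even
  subsets.
\<close>

text \<open>The factor 2 of the lower bound is the degree of g: regularity gives H_J(t+2) \<le>
  H_I(t+2) - H_I(t) for the apolar ideal J, and the sum telescopes to two final values of H_I.
  Linear forms would do better, but only combinations of the diagonal variables are apolar to the
  Hafnian, and these may all vanish on \<Gamma>, whereas the squares of all variables have no common
  zero. Polynomials in the new variable T never become objects: they are coefficient sequences, and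
  instead of passing to rational functions in T one compares unknowns and equations for sequences of
  bounded length. The explicit ideals are annihilators of shift-closed families of linear
  functionals, so their Hilbert functions count independent functionals. The variable x_11 can
  homogenize because it is absent from the Hafnian; the exponent j = 0 puts I inside the apolar
  ideal, and allowing every j makes y_11 a nonzerodivisor modulo I, whence I is saturated.\<close>

abbreviation (input) keys :: "('a \<Rightarrow>\<^sub>0 'b::zero) \<Rightarrow> 'a set" where
  "keys \<equiv> Poly_Mapping.keys"

abbreviation (input) lookup :: "('a \<Rightarrow>\<^sub>0 'b::zero) \<Rightarrow> 'a \<Rightarrow> 'b" where
  "lookup \<equiv> Poly_Mapping.lookup"

abbreviation (input) single :: "'a \<Rightarrow> 'b \<Rightarrow> 'a \<Rightarrow>\<^sub>0 'b::zero" where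
  "single \<equiv> Poly_Mapping.single"

section \<open>Polynomials\<close>

lemma mpoly_expand: "f = (\<Sum>a\<in>keys f. single a (lookup f a))"
proof (rule poly_mapping_eqI)
  fix m
  have "lookup (\<Sum>a\<in>keys f. single a (lookup f a)) m = (\<Sum>a\<in>keys f. if a = m then lookup f a else 0)"
    by (simp add: lookup_sum lookup_single when_def)
  also have "\<dots> = lookup f m"
    by (simp add: in_keys_iff)
  finally show "lookup f m = lookup (\<Sum>a\<in>keys f. single a (lookup f a)) m" ..
qed

lemma lookup_scalar_mult [simp]: "lookup (scalar_mult c f) m = c * lookup f m"
  unfolding scalar_mult_def mult_map_scale_conv_mult [symmetric]
  by (simp add: map.rep_eq when_def)

lemma keys_plus_monom: "keys (a + b :: monom) = keys a \<union> keys b"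
  by (auto simp: in_keys_iff lookup_add)

lemma monom_degree_superset:
  assumes "finite A" "keys a \<subseteq> A"
  shows "monom_degree a = (\<Sum>v\<in>A. lookup a v)"
  unfolding monom_degree_def
  using assms by (intro sum.mono_neutral_left) (auto simp: in_keys_iff)

lemma monom_degree_add: "monom_degree (a + b) = monom_degree a + monom_degree b"
proof -
  let ?A = "keys a \<union> keys b"
  have "monom_degree c = (\<Sum>v\<in>?A. lookup c v)" if "keys c \<subseteq> ?A" for c :: monom
    using that by (intro monom_degree_superset) auto
  then show ?thesis
    by (simp add: keys_plus_monom lookup_add sum.distrib)
qed

lemma monom_degree_zero [simp]: "monom_degree 0 = 0"
  by (simp add: monom_degree_def)

lemma monom_degree_single [simp]: "monom_degree (single v k) = k"
  by (simp add: monom_degree_def)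

lemma monom_degree_eq_0_iff: "monom_degree a = 0 \<longleftrightarrow> a = 0"
proof
  assume "monom_degree a = 0"
  then have "\<forall>v\<in>keys a. lookup a v = 0"
    by (simp add: monom_degree_def)
  then show "a = 0"
    by (metis in_keys_iff lookup_zero poly_mapping_eqI)
qed simp

lemma homogeneous_zero [simp]: "homogeneous d 0"
  by (simp add: homogeneous_def)

lemma homogeneous_add: "homogeneous d f \<Longrightarrow> homogeneous d g \<Longrightarrow> homogeneous d (f + g)"
  unfolding homogeneous_def by (auto dest!: subsetD[OF keys_add])

lemma homogeneous_single: "monom_degree a = d \<Longrightarrow> homogeneous d (single a c)"
  unfolding homogeneous_def by (auto simp: in_keys_iff lookup_single when_def split: if_splits)

lemma homogeneous_mult: "homogeneous d f \<Longrightarrow> homogeneous e g \<Longrightarrow> homogeneous (d + e) (f * g)"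
  unfolding homogeneous_def
proof
  fix m assume f: "\<forall>m\<in>keys f. monom_degree m = d" and g: "\<forall>m\<in>keys g. monom_degree m = e"
    and m: "m \<in> keys (f * g)"
  obtain a b where "m = a + b" "a \<in> keys f" "b \<in> keys g"
    using subsetD[OF keys_mult m] by blast
  with f g show "monom_degree m = d + e"
    by (simp add: monom_degree_add)
qed

lemma homogeneous_scalar_mult: "homogeneous d f \<Longrightarrow> homogeneous d (scalar_mult c f)"
  unfolding homogeneous_def by (auto simp: in_keys_iff)

lemma in_carrier_iff: "f \<in> carrier (poly_ring V) \<longleftrightarrow> (\<forall>m\<in>keys f. keys m \<subseteq> V)"
  by (simp add: poly_ring_def)

lemma poly_ring_simps [simp]:
  "mult (poly_ring V) = (*)" "one (poly_ring V) = 1" "ring.zero (poly_ring V) = 0"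
  "add (poly_ring V) = (+)"
  by (simp_all add: poly_ring_def)

lemma single_in_carrier: "keys a \<subseteq> V \<Longrightarrow> single a c \<in> carrier (poly_ring V)"
  by (auto simp: in_carrier_iff in_keys_iff lookup_single when_def split: if_splits)

lemma var_in_carrier: "v \<in> V \<Longrightarrow> var v \<in> carrier (poly_ring V)"
  unfolding var_def by (rule single_in_carrier) simp

lemma carrier_zero: "0 \<in> carrier (poly_ring V)"
  by (simp add: in_carrier_iff)

lemma carrier_add:
  "f \<in> carrier (poly_ring V) \<Longrightarrow> g \<in> carrier (poly_ring V) \<Longrightarrow> f + g \<in> carrier (poly_ring V)"
  unfolding in_carrier_iff by (auto dest!: subsetD[OF keys_add])

lemma carrier_uminus: "f \<in> carrier (poly_ring V) \<Longrightarrow> - f \<in> carrier (poly_ring V)"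
  unfolding in_carrier_iff by (auto simp: in_keys_iff)

lemma carrier_mult:
  "f \<in> carrier (poly_ring V) \<Longrightarrow> g \<in> carrier (poly_ring V) \<Longrightarrow> f * g \<in> carrier (poly_ring V)"
  unfolding in_carrier_iff
proof
  fix m assume f: "\<forall>m\<in>keys f. keys m \<subseteq> V" and g: "\<forall>m\<in>keys g. keys m \<subseteq> V"
    and m: "m \<in> keys (f * g)"
  obtain a b where "m = a + b" "a \<in> keys f" "b \<in> keys g"
    using subsetD[OF keys_mult m] by blast
  with f g show "keys m \<subseteq> V"
    by (simp add: keys_plus_monom)
qed

lemma cring_poly_ring: "cring (poly_ring V)"
proof (intro cringI abelian_groupI comm_monoidI)
  show "\<exists>y\<in>carrier (poly_ring V). y \<oplus>\<^bsub>poly_ring V\<^esub> x = \<zero>\<^bsub>poly_ring V\<^esub>"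
    if "x \<in> carrier (poly_ring V)" for x
    using carrier_uminus[OF that] by (intro bexI[of _ "- x"]) auto
  show "\<one>\<^bsub>poly_ring V\<^esub> \<in> carrier (poly_ring V)"
    by (simp add: in_carrier_iff)
qed (auto simp: carrier_zero carrier_add carrier_mult algebra_simps)

lemma ring_poly_ring: "ring (poly_ring V)"
  by (rule cring.axioms(1)[OF cring_poly_ring])

text \<open>Negatives are multiples by the constant \<open>- 1\<close>, so the subgroup axioms
  reduce to closure under sums.\<close>

lemma ideal_poly_ring_iff:
  fixes I :: "'k::field mpoly set"
  shows "ideal I (poly_ring V) \<longleftrightarrow> I \<subseteq> carrier (poly_ring V) \<and> 0 \<in> I \<and> (\<forall>f\<in>I. \<forall>g\<in>I. f + g \<in> I)
     \<and> (\<forall>f\<in>carrier (poly_ring V). \<forall>g\<in>I. f * g \<in> I)" (is "_ \<longleftrightarrow> ?R")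
proof
  assume "ideal I (poly_ring V)"
  then interpret ideal I "poly_ring V" .
  show ?R
    using a_subset additive_subgroup.zero_closed[OF is_additive_subgroup]
      additive_subgroup.a_closed[OF is_additive_subgroup] I_l_closed by auto
next
  assume R: ?R
  have comm: "f * g \<in> I" if "f \<in> I" "g \<in> carrier (poly_ring V)" for f g
    using R that by (metis mult.commute)
  show "ideal I (poly_ring V)"
  proof (rule idealI[OF ring_poly_ring])
    interpret ring "poly_ring V" by (rule ring_poly_ring)
    show "subgroup I (add_monoid (poly_ring V))"
    proof (rule add.subgroupI)
      fix f assume f: "f \<in> I"
      have m1: "single 0 (- 1) = (- 1 :: 'k mpoly)"
        by (metis single_one single_uminus)
      have "single 0 (- 1) * f \<in> I"
        using R f single_in_carrier[of 0 V "- 1 :: 'k"] by simp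
      then have *: "- f \<in> I"
        by (simp add: m1)
      have "\<ominus>\<^bsub>poly_ring V\<^esub> f = - f"
        using R f * by (intro minus_equality) auto
      with * show "\<ominus>\<^bsub>poly_ring V\<^esub> f \<in> I" by simp
    qed (use R in auto)
  qed (use R in \<open>auto intro: comm\<close>)
qed

lemma
  assumes "ideal I (poly_ring V)"
  shows ideal_subset: "I \<subseteq> carrier (poly_ring V)"
    and ideal_zero: "0 \<in> I"
    and ideal_add: "f \<in> I \<Longrightarrow> g \<in> I \<Longrightarrow> f + g \<in> I"
    and ideal_mult: "h \<in> carrier (poly_ring V) \<Longrightarrow> f \<in> I \<Longrightarrow> h * f \<in> I"
  using assms by (auto simp: ideal_poly_ring_iff)

lemma ideal_sum:
  assumes "ideal I (poly_ring V)" "\<And>i. i \<in> A \<Longrightarrow> f i \<in> I"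
  shows "sum f A \<in> I"
  using assms(2)
  by (induction A rule: infinite_finite_induct) (auto simp: ideal_zero[OF assms(1)] ideal_add[OF assms(1)])

lemma ideal_scalar_mult:
  assumes "ideal I (poly_ring V)" "f \<in> I"
  shows "scalar_mult c f \<in> I"
  unfolding scalar_mult_def by (rule ideal_mult[OF assms(1) _ assms(2)]) (rule single_in_carrier, simp)

lemma ideal_uminus:
  assumes "ideal I (poly_ring V)" "f \<in> I"
  shows "- f \<in> I"
proof -
  have "- f = scalar_mult (- 1) f"
    by (rule poly_mapping_eqI) simp
  then show ?thesis
    using ideal_scalar_mult[OF assms] by simp
qed

lemma ideal_diff:
  assumes "ideal I (poly_ring V)" "f \<in> I" "g \<in> I"
  shows "f - g \<in> I"
  using ideal_add[OF assms(1,2) ideal_uminus[OF assms(1,3)]] by simp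

lemma ideal_monomial_dvd:
  assumes "ideal I (poly_ring V)" "single a 1 \<in> I" "keys b \<subseteq> V"
  shows "single (a + b) c \<in> I"
proof -
  have "single b c * single a 1 \<in> I"
    by (rule ideal_mult[OF assms(1) single_in_carrier[OF assms(3)] assms(2)])
  then show ?thesis
    by (simp add: mult_single add.commute)
qed

lemma
  assumes "S \<subseteq> carrier (poly_ring V)"
  shows ideal_genideal: "ideal (Idl\<^bsub>poly_ring V\<^esub> S) (poly_ring V)"
    and genideal_superset: "S \<subseteq> Idl\<^bsub>poly_ring V\<^esub> S"
  using ring.genideal_ideal[OF ring_poly_ring assms] ring.genideal_self[OF ring_poly_ring assms] .

lemma genideal_least: "ideal I (poly_ring V) \<Longrightarrow> S \<subseteq> I \<Longrightarrow> Idl\<^bsub>poly_ring V\<^esub> S \<subseteq> I"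
  by (rule ring.genideal_minimal[OF ring_poly_ring])

section \<open>Contraction and ideals of inverse systems\<close>

text \<open>A function on monomials is an arbitrary linear functional, given by its values on the
  monomial basis; no finite support is asked of \<open>\<theta>\<close>.\<close>

definition pairing :: "'k::field mpoly \<Rightarrow> (monom \<Rightarrow> 'k) \<Rightarrow> 'k" where
  "pairing f \<theta> = (\<Sum>a\<in>keys f. lookup f a * \<theta> a)"

lemma pairing_superset:
  assumes "finite A" "keys f \<subseteq> A"
  shows "pairing f \<theta> = (\<Sum>a\<in>A. lookup f a * \<theta> a)"
  unfolding pairing_def
  using assms by (intro sum.mono_neutral_left) (auto simp: in_keys_iff)

lemma pairing_zero [simp]: "pairing 0 \<theta> = 0"
  by (simp add: pairing_def)

lemma pairing_add: "pairing (f + g) \<theta> = pairing f \<theta> + pairing g \<theta>"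
proof -
  let ?A = "keys f \<union> keys g"
  have "pairing h \<theta> = (\<Sum>a\<in>?A. lookup h a * \<theta> a)" if "keys h \<subseteq> ?A" for h
    using that by (intro pairing_superset) auto
  then show ?thesis
    using keys_add[of f g] by (simp add: lookup_add sum.distrib algebra_simps)
qed

lemma pairing_sum: "pairing (sum f A) \<theta> = (\<Sum>i\<in>A. pairing (f i) \<theta>)"
  by (induction A rule: infinite_finite_induct) (auto simp: pairing_add)

lemma pairing_single [simp]: "pairing (single a c) \<theta> = c * \<theta> a"
  by (subst pairing_superset[of "{a}"]) auto

lemma mpoly_mult_expand:
  "f * g = (\<Sum>a\<in>keys f. \<Sum>b\<in>keys g. single (a + b) (lookup f a * lookup g b))"
  by (subst mpoly_expand[of f], subst mpoly_expand[of g])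
    (simp add: sum_distrib_left sum_distrib_right mult_single, rule sum.swap)

text \<open>Multiplication is adjoint to shifting the functional, which is why a shift-closed family
  annihilates an ideal.\<close>

lemma pairing_mult:
  "pairing (f * g) \<theta> = (\<Sum>a\<in>keys f. lookup f a * pairing g (\<lambda>b. \<theta> (a + b)))"
  by (simp add: mpoly_mult_expand[of f g] pairing_sum pairing_def[of g] sum_distrib_left mult.assoc)

lemma pairing_single_mult: "pairing (single a 1 * g) \<theta> = pairing g (\<lambda>b. \<theta> (a + b))"
  by (simp add: pairing_mult)

text \<open>Divisibility together with \<open>b - a = m\<close> forces \<open>b = a + m\<close>, so
  each \<open>a\<close> meets at most one monomial of \<open>F\<close>. Contraction thus becomes a
  family of functionals indexed by \<open>m\<close>.\<close>

lemma lookup_contract: "lookup (contract \<Phi> F) m = pairing \<Phi> (\<lambda>a. lookup F (a + m))"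
proof -
  have "(\<Sum>b\<in>keys F. lookup (if \<forall>v. lookup a v \<le> lookup b v
            then single (b - a) (lookup \<Phi> a * lookup F b) else 0) m)
        = lookup \<Phi> a * lookup F (a + m)" for a
  proof -
    have *: "b = a + m" if "\<forall>v. lookup a v \<le> lookup b v" "b - a = m" for b
      using that by (intro poly_mapping_eqI) (auto simp: lookup_add lookup_minus)
    have "(\<Sum>b\<in>keys F. lookup (if \<forall>v. lookup a v \<le> lookup b v
            then single (b - a) (lookup \<Phi> a * lookup F b) else 0) m)
        = (\<Sum>b\<in>keys F. if b = a + m then lookup \<Phi> a * lookup F b else 0)"
      using * by (intro sum.cong) (auto simp: lookup_single when_def lookup_add)
    also have "\<dots> = lookup \<Phi> a * lookup F (a + m)"
      by (auto simp: in_keys_iff)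
    finally show ?thesis .
  qed
  then show ?thesis
    by (simp add: contract_def lookup_sum pairing_def)
qed

text \<open>Macaulay's inverse systems, written with functionals in place of polynomials.\<close>

definition inverse_system_ideal ::
    "(nat \<times> nat) set \<Rightarrow> (monom \<Rightarrow> 'k) set \<Rightarrow> 'k::field mpoly set" where
  "inverse_system_ideal V \<Theta> = {f \<in> carrier (poly_ring V). \<forall>\<theta>\<in>\<Theta>. pairing f \<theta> = 0}"

lemma apolar_ideal_eq:
  "apolar_ideal V F = inverse_system_ideal V (range (\<lambda>m a. lookup F (a + m)))"
  by (auto simp: apolar_ideal_def inverse_system_ideal_def poly_mapping_eq_iff fun_eq_iff lookup_contract)

lemma ideal_inverse_system:
  assumes shift: "\<And>\<theta> a. \<theta> \<in> \<Theta> \<Longrightarrow> (\<lambda>b. \<theta> (a + b)) \<in> \<Theta>"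
  shows "ideal (inverse_system_ideal V \<Theta>) (poly_ring V)"
  unfolding ideal_poly_ring_iff inverse_system_ideal_def
  using shift by (auto simp: carrier_zero carrier_add carrier_mult pairing_add pairing_mult)

definition hom_component :: "nat \<Rightarrow> 'k::field mpoly \<Rightarrow> 'k mpoly" where
  "hom_component d f = (\<Sum>a\<in>{a\<in>keys f. monom_degree a = d}. single a (lookup f a))"

lemma lookup_hom_component:
  "lookup (hom_component d f) a = (if monom_degree a = d then lookup f a else 0)"
  by (auto simp: hom_component_def lookup_sum lookup_single when_def in_keys_iff)

lemma keys_hom_component: "keys (hom_component d f) = {a\<in>keys f. monom_degree a = d}"
  by (auto simp: in_keys_iff lookup_hom_component split: if_splits)

lemma homogeneous_hom_component: "homogeneous d (hom_component d f)"
  by (simp add: homogeneous_def keys_hom_component)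

lemma sum_hom_components: "f = (\<Sum>d\<in>monom_degree ` keys f. hom_component d f)"
  by (rule poly_mapping_eqI) (auto simp: lookup_sum lookup_hom_component in_keys_iff image_iff)

lemma homogeneous_idealI:
  assumes I: "ideal I (poly_ring V)"
    and comp: "\<And>f d. f \<in> I \<Longrightarrow> hom_component d f \<in> I"
  shows "homogeneous_ideal V I"
  unfolding homogeneous_ideal_def
proof (intro conjI equalityI subsetI)
  let ?H = "{f \<in> I. \<exists>d. homogeneous d f}"
  have H: "?H \<subseteq> carrier (poly_ring V)"
    using ideal_subset[OF I] by auto
  show "f \<in> Idl\<^bsub>poly_ring V\<^esub> ?H" if "f \<in> I" for f
  proof (subst sum_hom_components[of f], rule ideal_sum[OF ideal_genideal[OF H]])
    show "hom_component d f \<in> Idl\<^bsub>poly_ring V\<^esub> ?H" for d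
      using genideal_superset[OF H] comp[OF that] homogeneous_hom_component by blast
  qed
  show "f \<in> I" if "f \<in> Idl\<^bsub>poly_ring V\<^esub> ?H" for f
    using genideal_least[OF I, of ?H] that by auto
qed (rule I)

text \<open>A functional supported in one degree sees only the component of \<open>f\<close> in that
  degree, so if it kills \<open>f\<close> it kills every component.\<close>

lemma homogeneous_inverse_system:
  assumes shift: "\<And>\<theta> a. \<theta> \<in> \<Theta> \<Longrightarrow> (\<lambda>b. \<theta> (a + b)) \<in> \<Theta>"
    and graded: "\<And>\<theta> a b. \<theta> \<in> \<Theta> \<Longrightarrow> \<theta> a \<noteq> 0 \<Longrightarrow> \<theta> b \<noteq> 0 \<Longrightarrow> monom_degree a = monom_degree b"
  shows "homogeneous_ideal V (inverse_system_ideal V \<Theta>)"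
proof (rule homogeneous_idealI)
  show "ideal (inverse_system_ideal V \<Theta>) (poly_ring V)"
    by (rule ideal_inverse_system) (rule shift)
next
  fix f d assume f: "f \<in> inverse_system_ideal V \<Theta>"
  have "pairing (hom_component d f) \<theta> = 0" if \<theta>: "\<theta> \<in> \<Theta>" for \<theta>
  proof (cases "\<exists>a. \<theta> a \<noteq> 0 \<and> monom_degree a = d")
    case True
    then have "lookup (hom_component d f) a * \<theta> a = lookup f a * \<theta> a" for a
      using graded[OF \<theta>] by (auto simp: lookup_hom_component)
    then have "pairing (hom_component d f) \<theta> = pairing f \<theta>"
      unfolding pairing_def[of f]
      by (subst pairing_superset[of "keys f"]) (auto simp: keys_hom_component intro: sum.cong simp del: mult_cancel_right)
    then show ?thesis
      using f \<theta> by (simp add: inverse_system_ideal_def)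
  next
    case False
    then show ?thesis
      by (auto simp: pairing_def keys_hom_component intro!: sum.neutral)
  qed
  then show "hom_component d f \<in> inverse_system_ideal V \<Theta>"
    using f by (auto simp: inverse_system_ideal_def in_carrier_iff keys_hom_component)
qed

section \<open>Dimensions of graded pieces\<close>

lemma scalar_mult_vector_space: "vector_space (scalar_mult :: 'k::field \<Rightarrow> 'k mpoly \<Rightarrow> 'k mpoly)"
  by unfold_locales (auto intro!: poly_mapping_eqI simp: lookup_add algebra_simps)

global_interpretation mpoly: vector_space "scalar_mult :: 'k::field \<Rightarrow> 'k mpoly \<Rightarrow> 'k mpoly"
  by (rule scalar_mult_vector_space)

lemma mult_scalar_mult_right: "f * scalar_mult c g = scalar_mult c (f * g)"
  by (simp add: scalar_mult_def mult.left_commute)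

section \<open>Bases modulo a subspace\<close>

context vector_space
begin

text \<open>Reads off coordinates modulo \<open>A\<close>; they become the matrix of a
  multiplication map without any quotient space being formed.\<close>

lemma span_Un_obtain:
  assumes "subspace A" "finite C" "x \<in> span (A \<union> C)"
  obtains \<alpha> where "x - (\<Sum>u\<in>C. \<alpha> u *s u) \<in> A"
proof -
  obtain a y where "x = a + y" "a \<in> A" "y \<in> span C"
    using assms(3) unfolding span_Un span_eq_iff[THEN iffD2, OF assms(1)] by blast
  moreover obtain \<alpha> where "y = (\<Sum>u\<in>C. \<alpha> u *s u)"
    using \<open>y \<in> span C\<close> unfolding span_finite[OF assms(2)] by blast
  ultimately show thesis
    using that[of \<alpha>] by simp
qed

lemma finite_basis_obtain:
  assumes "finite T" "B \<subseteq> span T" "S \<subseteq> B" "independent S"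
  obtains B' where "finite B'" "S \<subseteq> B'" "B' \<subseteq> B" "independent B'" "B \<subseteq> span B'" "card B' = dim B"
proof -
  obtain B' where B': "S \<subseteq> B'" "B' \<subseteq> B" "independent B'" "B \<subseteq> span B'"
    using maximal_independent_subset_extend[OF assms(3,4)] .
  moreover have "finite B'"
    using independent_span_bound[OF assms(1) B'(3)] B'(2) assms(2) by blast
  moreover have "card B' = dim B"
    by (rule basis_card_eq_dim[OF B'(2,4,3)])
  ultimately show thesis
    using that by blast
qed

text \<open>\<open>C\<close> stands for a basis of the quotient of \<open>B\<close> by
  \<open>A\<close>: extend a basis of \<open>A\<close> to one of \<open>B\<close> and drop the old
  part. The last clause is independence modulo \<open>A\<close>.\<close>

lemma relative_basis_obtain:
  assumes T: "finite T" "B \<subseteq> span T" and A: "subspace A" "A \<subseteq> B"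
  obtains C where "finite C" "C \<subseteq> B" "card C + dim A = dim B" "B \<subseteq> span (A \<union> C)"
    "\<And>c x. (\<Sum>x\<in>C. c x *s x) \<in> A \<Longrightarrow> x \<in> C \<Longrightarrow> c x = 0"
proof -
  have AT: "A \<subseteq> span T" using A T by blast
  obtain A0 where A0: "finite A0" "A0 \<subseteq> A" "independent A0" "A \<subseteq> span A0" "card A0 = dim A"
    using finite_basis_obtain[OF T(1) AT empty_subsetI independent_empty] .
  have "A0 \<subseteq> B" using A0 A by blast
  then obtain B0 where B0: "finite B0" "A0 \<subseteq> B0" "B0 \<subseteq> B" "independent B0" "B \<subseteq> span B0" "card B0 = dim B"
    using finite_basis_obtain[OF T _ A0(3)] by blast
  show thesis
  proof
    show "finite (B0 - A0)" "B0 - A0 \<subseteq> B" using B0 by auto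
    show "card (B0 - A0) + dim A = dim B"
      using A0 B0 by (metis card_Diff_subset card_mono le_add_diff_inverse2)
    show "B \<subseteq> span (A \<union> (B0 - A0))"
      using B0(5) span_mono[of B0 "A \<union> (B0 - A0)"] A0(2) by blast
  next
    fix c x assume c: "(\<Sum>x\<in>B0 - A0. c x *s x) \<in> A" and x: "x \<in> B0 - A0"
    obtain d where d: "(\<Sum>x\<in>B0 - A0. c x *s x) = (\<Sum>x\<in>A0. d x *s x)"
      using c A0(4) unfolding span_finite[OF A0(1)] by blast
    \<comment> \<open>A combination of \<open>B0 - A0\<close> with value in \<open>A\<close> becomes
      a relation on all of \<open>B0\<close> once that value is moved across, hence the minus
      sign.\<close>
    define e where "e y = (if y \<in> A0 then - d y else c y)" for y
    have "(\<Sum>y\<in>B0. e y *s y) = (\<Sum>y\<in>B0 - A0. e y *s y) + (\<Sum>y\<in>A0. e y *s y)"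
      by (rule sum.subset_diff[OF B0(2,1)])
    also have "(\<Sum>y\<in>A0. e y *s y) = - (\<Sum>x\<in>A0. d x *s x)"
      unfolding sum_negf[symmetric] by (intro sum.cong) (auto simp: e_def)
    also have "(\<Sum>y\<in>B0 - A0. e y *s y) = (\<Sum>x\<in>B0 - A0. c x *s x)"
      by (intro sum.cong) (auto simp: e_def)
    finally have "(\<Sum>y\<in>B0. e y *s y) = 0"
      using d by simp
    then have "e x = 0"
      using independentD[OF B0(4) B0(1) subset_refl] x by blast
    then show "c x = 0"
      using x by (simp add: e_def)
  qed
qed

lemma dim_add_card_eq:
  assumes T: "finite T" "W \<subseteq> span T" and A: "subspace A" "A \<subseteq> W"
    and C: "finite C" "C \<subseteq> W" "W \<subseteq> span (A \<union> C)"
    and indep: "\<And>c x. (\<Sum>x\<in>C. c x *s x) \<in> A \<Longrightarrow> x \<in> C \<Longrightarrow> c x = 0"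
  shows "dim W = dim A + card C"
proof -
  have AT: "A \<subseteq> span T" using A T by blast
  obtain A0 where A0: "finite A0" "A0 \<subseteq> A" "independent A0" "A \<subseteq> span A0" "card A0 = dim A"
    using finite_basis_obtain[OF T(1) AT empty_subsetI independent_empty] .
  have disj: "A0 \<inter> C = {}"
  proof (rule ccontr)
    assume "A0 \<inter> C \<noteq> {}"
    then obtain x where x: "x \<in> A0" "x \<in> C" by blast
    \<comment> \<open>The unit coefficient vector at \<open>x\<close> gives a combination lying in
      \<open>A\<close>, against independence modulo \<open>A\<close>.\<close>
    have "(\<Sum>y\<in>C. (if y = x then 1 else 0) *s y) = x"
      using C(1) x(2) by (simp add: if_distrib[of "\<lambda>c. c *s _"] cong: if_cong)
    then have "(if x = x then 1 else 0 :: 'a) = 0"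
      using indep[of "\<lambda>y. if y = x then 1 else 0" x] x A0(2) by auto
    then show False by simp
  qed
  have "independent (A0 \<union> C)"
  proof (rule independent_if_scalars_zero)
    show "finite (A0 \<union> C)" using A0 C by simp
    fix f x assume "(\<Sum>x\<in>A0 \<union> C. f x *s x) = 0" and x: "x \<in> A0 \<union> C"
    then have sum0: "(\<Sum>x\<in>A0. f x *s x) + (\<Sum>x\<in>C. f x *s x) = 0"
      using sum.union_disjoint[OF A0(1) C(1) disj] by metis
    then have "(\<Sum>x\<in>C. f x *s x) = (\<Sum>x\<in>A0. - f x *s x)"
      by (simp add: sum_negf eq_neg_iff_add_eq_0 add.commute)
    also have "\<dots> \<in> A"
      using A0(2) by (intro subspace_sum[OF A(1)] subspace_scale[OF A(1)]) auto
    finally have f0: "\<And>y. y \<in> C \<Longrightarrow> f y = 0"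
      using indep by blast
    then have "(\<Sum>x\<in>A0. f x *s x) = 0"
      using sum0 by simp
    then show "f x = 0"
      using x f0 independentD[OF A0(3,1) subset_refl] by blast
  qed
  moreover have "A0 \<union> C \<subseteq> W" using A0 A C by blast
  moreover have "W \<subseteq> span (A0 \<union> C)"
  proof -
    have "A \<union> C \<subseteq> span (A0 \<union> C)"
      using A0(4) span_mono[of A0 "A0 \<union> C"] span_superset[of "A0 \<union> C"] by blast
    then show ?thesis
      using C(3) span_minimal[OF _ subspace_span] by blast
  qed
  ultimately have "card (A0 \<union> C) = dim W"
    using basis_card_eq_dim by blast
  then show ?thesis
    using card_Un_disjoint[OF A0(1) C(1) disj] A0(5) by simp
qed

end

section \<open>Graded pieces of an ideal\<close>

definition monomials :: "(nat \<times> nat) set \<Rightarrow> nat \<Rightarrow> monom set" where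
  "monomials V t = {a. keys a \<subseteq> V \<and> monom_degree a = t}"

definition graded_part :: "nat \<Rightarrow> 'k::field mpoly set \<Rightarrow> 'k mpoly set" where
  "graded_part t I = {f \<in> I. homogeneous t f}"

lemma hilbert_function_eq:
  fixes I :: "'k::field mpoly set"
  shows "hilbert_function V I t
     = mpoly.dim (graded_part t (carrier (poly_ring V) :: 'k mpoly set)) - mpoly.dim (graded_part t I)"
  by (simp add: hilbert_function_def graded_part_def)

lemma finite_monomials:
  assumes "finite V"
  shows "finite (monomials V t)"
proof -
  have "lookup ` monomials V t \<subseteq> {f. \<forall>v. (v \<in> V \<longrightarrow> f v \<in> {..t}) \<and> (v \<notin> V \<longrightarrow> f v = 0)}"
  proof (intro image_subsetI CollectI allI conjI impI)
    fix a v assume a: "a \<in> monomials V t"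
    have "lookup a v \<le> monom_degree a" if "v \<in> keys a"
      unfolding monom_degree_def by (rule member_le_sum) (use that in auto)
    then show "lookup a v \<in> {..t}"
      using a by (cases "v \<in> keys a") (auto simp: monomials_def in_keys_iff)
    show "lookup a v = 0" if "v \<notin> V"
      using a that by (auto simp: monomials_def in_keys_iff)
  qed
  then have "finite (lookup ` monomials V t)"
    by (rule finite_subset) (intro finite_set_of_finite_funs assms finite_atMost)
  then show ?thesis
    by (rule finite_imageD) (auto intro!: inj_onI poly_mapping_eqI)
qed

lemma keys_graded_part:
  "f \<in> graded_part t (carrier (poly_ring V)) \<longleftrightarrow> keys f \<subseteq> monomials V t"
  by (auto simp: graded_part_def in_carrier_iff homogeneous_def monomials_def)

lemma graded_part_span:
  "graded_part t (carrier (poly_ring V)) \<subseteq> mpoly.span ((\<lambda>a. single a 1) ` monomials V t)"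
proof
  fix f :: "'a mpoly" assume "f \<in> graded_part t (carrier (poly_ring V))"
  then have f: "keys f \<subseteq> monomials V t"
    by (simp add: keys_graded_part)
  have "f = (\<Sum>a\<in>keys f. scalar_mult (lookup f a) (single a 1))"
    by (subst mpoly_expand) (simp add: scalar_mult_def mult_single)
  also have "\<dots> \<in> mpoly.span ((\<lambda>a. single a 1) ` monomials V t)"
    using f by (intro mpoly.span_sum mpoly.span_scale mpoly.span_base) auto
  finally show "f \<in> mpoly.span ((\<lambda>a. single a 1) ` monomials V t)" .
qed

lemma graded_part_mono: "I \<subseteq> J \<Longrightarrow> graded_part t I \<subseteq> graded_part t J"
  by (auto simp: graded_part_def)

lemma ideal_carrier: "ideal (carrier (poly_ring V)) (poly_ring V)"
  by (simp add: ideal_poly_ring_iff carrier_zero carrier_add carrier_mult)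

lemma subspace_graded_part:
  assumes "ideal I (poly_ring V)"
  shows "mpoly.subspace (graded_part t I)"
  by (rule mpoly.subspaceI)
    (auto simp: graded_part_def homogeneous_add homogeneous_scalar_mult ideal_zero[OF assms]
       ideal_add[OF assms] ideal_scalar_mult[OF assms])

text \<open>
  This is McCoy's theorem on zero divisors in a polynomial ring, for the polynomials
  \<open>\<Sum>\<^sub>i g\<^sub>i T\<^sup>i\<close> and \<open>\<Sum>\<^sub>k w\<^sub>k T\<^sup>k\<close> modulo \<open>I\<close>. The new variable \<open>T\<close> makes \<open>\<Sum>\<^sub>i g\<^sub>i T\<^sup>i\<close> a substitute
  for a general linear combination of the \<open>g\<^sub>i\<close>, which need not exist over a finite field.
\<close>

lemma mccoy:
  fixes g w :: "nat \<Rightarrow> 'a::comm_ring_1"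
  assumes I0: "0 \<in> I" and Idiff: "\<And>f h. f \<in> I \<Longrightarrow> h \<in> I \<Longrightarrow> f - h \<in> I"
    and Imult: "\<And>i f. f \<in> I \<Longrightarrow> g i * f \<in> I" and Mmult: "\<And>i f. f \<in> M \<Longrightarrow> g i * f \<in> M"
    and g0: "\<And>i. i \<ge> m \<Longrightarrow> g i = 0"
    and regular: "\<And>f. f \<in> M \<Longrightarrow> (\<And>i. g i * f \<in> I) \<Longrightarrow> f \<in> I"
    and "\<And>k. k < L \<Longrightarrow> w k \<in> M"
    and "\<And>s. (\<Sum>k<L. if k \<le> s then g (s - k) * w k else 0) \<in> I"
    and "k < L"
  shows "w k \<in> I"
  using assms(7-)
proof (induction L arbitrary: w k)
  case 0
  then show ?case by simp
next
  case (Suc L)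
  have Iadd: "f + h \<in> I" if "f \<in> I" "h \<in> I" for f h
    using Idiff[OF that(1) Idiff[OF I0 that(2)]] by simp
  have Isum: "sum f A \<in> I" if "\<And>i. i \<in> A \<Longrightarrow> f i \<in> I" for f :: "nat \<Rightarrow> 'a" and A
    using that by (induction A rule: infinite_finite_induct) (auto simp: I0 Iadd)
  \<comment> \<open>The index \<open>i\<close> descends from \<open>m\<close>, where the
    coefficients vanish: induction on \<open>m - i\<close>.\<close>
  have top: "g i * w k \<in> I" if "k \<le> L" for i k
    using that
  proof (induction "m - i" arbitrary: i k rule: less_induct)
    case less
    show ?case
    proof (cases "i < m")
      case False
      then show ?thesis by (simp add: g0 I0)
    next
      case True
      \<comment> \<open>In the coefficient of index \<open>i + L\<close> every term except
        \<open>g i * w L\<close> has a factor \<open>g\<close> of index above \<open>i\<close>, so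
        it is already in \<open>I\<close>.\<close>
      have "(\<Sum>k<L. if k \<le> i + L then g (i + L - k) * w k else 0) \<in> I"
      proof (rule Isum)
        fix k assume "k \<in> {..<L}"
        moreover from this have "m - (i + L - k) < m - i"
          using True by auto
        ultimately show "(if k \<le> i + L then g (i + L - k) * w k else 0) \<in> I"
          using less(1)[of "i + L - k" k] by (simp add: I0)
      qed
      then have wL: "g i * w L \<in> I"
        using Idiff[OF Suc.prems(2)[of "i + L"]] by fastforce
      \<comment> \<open>Multiplied by \<open>g i\<close>, the polynomial \<open>w\<close> loses its
        top coefficient modulo \<open>I\<close>, so the outer induction applies to the rest.\<close>
      have "g i * w k \<in> I" if "k < L" for k
      proof (rule Suc.IH[OF _ _ that])
        show "g i * w k \<in> M" if "k < L" for k
          using that by (intro Mmult Suc.prems) simp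
        fix s
        have "(\<Sum>k<L. if k \<le> s then g (s - k) * (g i * w k) else 0)
          = g i * (\<Sum>k<Suc L. if k \<le> s then g (s - k) * w k else 0)
            - (if L \<le> s then g (s - L) * (g i * w L) else 0)"
          by (simp add: sum_distrib_left if_distrib[of "\<lambda>x. g i * x"] mult.left_commute distrib_left
              cong: if_cong)
        also have "\<dots> \<in> I"
        proof (rule Idiff)
          show "g i * (\<Sum>k<Suc L. if k \<le> s then g (s - k) * w k else 0) \<in> I"
            by (rule Imult, rule Suc.prems(2))
          show "(if L \<le> s then g (s - L) * (g i * w L) else 0) \<in> I"
            using Imult[OF wL] I0 by simp
        qed
        finally show "(\<Sum>k<L. if k \<le> s then g (s - k) * (g i * w k) else 0) \<in> I" .
      qed
      then show ?thesis
        using wL less.prems by (cases "k = L") auto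
    qed
  qed
  show ?case
  proof (rule regular)
    show "w k \<in> M" using Suc.prems(1,3) .
    show "g i * w k \<in> I" for i using Suc.prems(3) by (intro top) simp
  qed
qed

text \<open>Gaussian elimination: an equation with a nonzero coefficient at \<open>z\<close> is
  solved for \<open>z\<close>, which removes one equation and one unknown.\<close>

lemma underdetermined_system:
  fixes M :: "'e \<Rightarrow> 'x \<Rightarrow> 'k::field"
  assumes "finite E" "finite X" "card E < card X"
  shows "\<exists>c. (\<exists>x\<in>X. c x \<noteq> 0) \<and> (\<forall>e\<in>E. (\<Sum>x\<in>X. M e x * c x) = 0)"
  using assms
proof (induction E arbitrary: X M rule: finite_induct)
  case empty
  then have "X \<noteq> {}" by auto
  then show ?case by (intro exI[of _ "\<lambda>_. 1"]) auto
next
  case (insert e E)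
  show ?case
  proof (cases "\<forall>x\<in>X. M e x = 0")
    case True
    have "card E < card X" using insert by simp
    from insert.IH[OF insert.prems(1) this, of M] True show ?thesis
      by auto
  next
    case False
    then obtain z where z: "z \<in> X" "M e z \<noteq> 0" by blast
    define Y where "Y = X - {z}"
    have Y: "finite Y" "z \<notin> Y" "X = insert z Y"
      using insert.prems z by (auto simp: Y_def)
    have "card E < card Y"
      using insert Y by simp
    then obtain c where c: "\<exists>x\<in>Y. c x \<noteq> 0"
      "\<And>e'. e' \<in> E \<Longrightarrow> (\<Sum>x\<in>Y. (M e' x - M e' z * M e x / M e z) * c x) = 0"
      using insert.IH[OF Y(1), of "\<lambda>e' x. M e' x - M e' z * M e x / M e z"] by blast
    define d where "d x = (if x = z then - (\<Sum>x\<in>Y. M e x * c x) / M e z else c x)" for x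
    have split: "(\<Sum>x\<in>X. M e' x * d x)
        = M e' z * (- (\<Sum>x\<in>Y. M e x * c x) / M e z) + (\<Sum>x\<in>Y. M e' x * c x)" for e'
    proof -
      have "(\<Sum>x\<in>Y. M e' x * d x) = (\<Sum>x\<in>Y. M e' x * c x)"
        using Y(2) by (intro sum.cong) (auto simp: d_def)
      then show ?thesis
        using Y by (simp add: d_def)
    qed
    have "(\<Sum>x\<in>X. M e' x * d x) = 0" if "e' \<in> E" for e'
    proof -
      have "(\<Sum>x\<in>Y. M e' x * c x) - M e' z / M e z * (\<Sum>x\<in>Y. M e x * c x)
          = (\<Sum>x\<in>Y. (M e' x - M e' z * M e x / M e z) * c x)"
        by (simp add: sum_distrib_left sum_subtractf algebra_simps)
      then show ?thesis
        using c(2)[OF that] unfolding split by (simp add: algebra_simps)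
    qed
    moreover have "(\<Sum>x\<in>X. M e x * d x) = 0"
      unfolding split using z by simp
    moreover have "\<exists>x\<in>X. d x \<noteq> 0"
      using c(1) Y by (auto simp: d_def)
    ultimately show ?thesis by blast
  qed
qed

text \<open>Multiplication by the polynomial in T with coefficients \<open>g i\<close> is injective
  modulo \<open>I\<close> and lands in \<open>N\<close>; hence the quotient of S by \<open>I\<close>
  in degree \<open>t\<close> is no larger than \<open>N\<close> modulo \<open>I\<close>. The
  inequality is additive to avoid truncated subtraction.\<close>

lemma mult_dim_le:
  fixes V and I :: "'k::field mpoly set" and g :: "nat \<Rightarrow> 'k mpoly"
  assumes V: "finite V" and I: "ideal I (poly_ring V)"
    and g: "\<And>i. g i \<in> carrier (poly_ring V)" and g0: "\<And>i. i \<ge> m \<Longrightarrow> g i = 0"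
    and regular: "\<And>f. f \<in> carrier (poly_ring V) \<Longrightarrow> (\<And>i. g i * f \<in> I) \<Longrightarrow> f \<in> I"
    and N: "mpoly.subspace N" "graded_part u I \<subseteq> N" "N \<subseteq> graded_part u (carrier (poly_ring V))"
    and gN: "\<And>i f. f \<in> graded_part t (carrier (poly_ring V)) \<Longrightarrow> g i * f \<in> N"
  shows "mpoly.dim (graded_part t (carrier (poly_ring V) :: 'k mpoly set)) + mpoly.dim (graded_part u I)
    \<le> mpoly.dim N + mpoly.dim (graded_part t I)"
proof -
  let ?S = "carrier (poly_ring V) :: 'k mpoly set"
  have IS: "graded_part t I \<subseteq> graded_part t ?S"
    by (intro graded_part_mono ideal_subset I)
  have fin: "finite ((\<lambda>a. single a (1::'k)) ` monomials V n)" for n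
    by (intro finite_imageI finite_monomials V)
  obtain C where C: "finite C" "C \<subseteq> graded_part t ?S"
      "card C + mpoly.dim (graded_part t I) = mpoly.dim (graded_part t ?S)"
      "graded_part t ?S \<subseteq> mpoly.span (graded_part t I \<union> C)"
    and C_indep: "\<And>c x. (\<Sum>x\<in>C. scalar_mult (c x) x) \<in> graded_part t I \<Longrightarrow> x \<in> C \<Longrightarrow> c x = 0"
    using mpoly.relative_basis_obtain[OF fin graded_part_span subspace_graded_part[OF I] IS]
    by blast
  have NT: "N \<subseteq> mpoly.span ((\<lambda>a. single a 1) ` monomials V u)"
    using N(3) graded_part_span by blast
  obtain D where D: "finite D" "D \<subseteq> N"
      "card D + mpoly.dim (graded_part u I) = mpoly.dim N"
      "N \<subseteq> mpoly.span (graded_part u I \<union> D)"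
    by (rule mpoly.relative_basis_obtain[OF fin NT subspace_graded_part[OF I] N(2)]) (rule that)
  have "\<forall>j x. \<exists>\<alpha>. x \<in> C \<longrightarrow> g j * x - (\<Sum>y\<in>D. scalar_mult (\<alpha> y) y) \<in> graded_part u I"
  proof (intro allI)
    fix j x
    show "\<exists>\<alpha>. x \<in> C \<longrightarrow> g j * x - (\<Sum>y\<in>D. scalar_mult (\<alpha> y) y) \<in> graded_part u I"
    proof (cases "x \<in> C")
      case True
      then have "g j * x \<in> mpoly.span (graded_part u I \<union> D)"
        using gN[of x j] C(2) D(4) by auto
      then obtain \<alpha> where "g j * x - (\<Sum>y\<in>D. scalar_mult (\<alpha> y) y) \<in> graded_part u I"
        by (rule mpoly.span_Un_obtain[OF subspace_graded_part[OF I] D(1)])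
      then show ?thesis by (intro exI) (rule impI)
    qed simp
  qed
  then obtain \<alpha> where
    "\<forall>j x. x \<in> C \<longrightarrow> g j * x - (\<Sum>y\<in>D. scalar_mult (\<alpha> j x y) y) \<in> graded_part u I"
    unfolding choice_iff ..
  then have \<alpha>: "\<And>j x. x \<in> C \<Longrightarrow> g j * x - (\<Sum>y\<in>D. scalar_mult (\<alpha> j x y) y) \<in> graded_part u I"
    by simp
  have "card C \<le> card D"
  proof (rule ccontr)
    assume "\<not> card C \<le> card D"
    then have less: "card D + 1 \<le> card C" by simp
    \<comment> \<open>Sequences of length \<open>L\<close> over \<open>C\<close> give
      \<open>L * card C\<close> unknowns; their products have length at most \<open>L + m\<close>,
      giving \<open>(L + m) * card D\<close> equations. This \<open>L\<close> outgrows the surplus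
      \<open>m * card D\<close>.\<close>
    define L where "L = m * card D + 1"
    have "(L + m) * card D < L * (card D + 1)"
      by (simp add: L_def algebra_simps)
    also have "\<dots> \<le> L * card C"
      using less by (rule mult_le_mono2)
    finally have "card ({..<L + m} \<times> D) < card ({..<L} \<times> C)"
      by (simp add: card_cartesian_product)
    \<comment> \<open>Unknowns are the coefficients of \<open>w\<close> on \<open>C\<close>,
      equations the coordinates on \<open>D\<close> of each power of T in the product.\<close>
    from underdetermined_system[OF _ _ this, of "\<lambda>q p. if fst p \<le> fst q then \<alpha> (fst q - fst p) (snd p) (snd q) else 0"]
    obtain c where c0: "\<exists>p\<in>{..<L} \<times> C. c p \<noteq> 0"
      and c1: "\<forall>q\<in>{..<L + m} \<times> D. (\<Sum>p\<in>{..<L} \<times> C.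
        (if fst p \<le> fst q then \<alpha> (fst q - fst p) (snd p) (snd q) else 0) * c p) = 0"
      using C(1) D(1) by auto
    have c: "(\<Sum>i<L. \<Sum>x\<in>C. (if i \<le> s then \<alpha> (s - i) x y else 0) * c (i, x)) = 0"
      if "s < L + m" "y \<in> D" for s y
      using bspec[OF c1, of "(s, y)"] that unfolding fst_conv snd_conv
      by (simp add: sum.cartesian_product case_prod_beta del: mult_eq_0_iff)
    define w where "w i = (\<Sum>x\<in>C. scalar_mult (c (i, x)) x)" for i
    have wS: "w i \<in> graded_part t ?S" for i
      unfolding w_def using C(2) subspace_graded_part[OF ideal_carrier]
      by (intro mpoly.subspace_sum mpoly.subspace_scale) auto
    have conv: "(\<Sum>k<L. if k \<le> s then g (s - k) * w k else 0) \<in> I" for s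
    proof (cases "s < L + m")
      case False
      then have "(\<Sum>k<L. if k \<le> s then g (s - k) * w k else 0) = 0"
        by (intro sum.neutral) (auto simp: g0)
      then show ?thesis
        using ideal_zero[OF I] by simp
    next
      case True
      \<comment> \<open>The contribution of \<open>x\<close> in \<open>w k\<close> to the
        coefficient \<open>s\<close> of the product, expressed on \<open>D\<close> modulo
        \<open>I\<close>. The choice of \<open>c\<close> makes these contributions cancel.\<close>
      define r where "r k x = (\<Sum>y\<in>D. scalar_mult ((if k \<le> s then \<alpha> (s - k) x y else 0) * c (k, x)) y)" for k x
      have "(\<Sum>k<L. \<Sum>x\<in>C. r k x)
        = (\<Sum>y\<in>D. scalar_mult (\<Sum>k<L. \<Sum>x\<in>C. (if k \<le> s then \<alpha> (s - k) x y else 0) * c (k, x)) y)"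
        unfolding r_def mpoly.scale_sum_left
        by (simp only: sum.swap[of _ "{..<L}" D] sum.swap[of _ C D])
      also have "\<dots> = 0"
        using c[OF True] by simp
      finally have r0: "(\<Sum>k<L. \<Sum>x\<in>C. r k x) = 0" .
      have "(if k \<le> s then g (s - k) * w k else 0) - (\<Sum>x\<in>C. r k x) \<in> I" for k
      proof (cases "k \<le> s")
        case ks: True
        have "g (s - k) * w k - (\<Sum>x\<in>C. r k x)
          = (\<Sum>x\<in>C. scalar_mult (c (k, x)) (g (s - k) * x - (\<Sum>y\<in>D. scalar_mult (\<alpha> (s - k) x y) y)))"
          using ks by (simp add: w_def r_def sum_distrib_left sum_subtractf mult_scalar_mult_right
              mpoly.scale_right_diff_distrib mpoly.scale_sum_right mult.commute)
        also have "\<dots> \<in> I"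
          using \<alpha> by (intro ideal_sum[OF I] ideal_scalar_mult[OF I]) (simp add: graded_part_def)
        finally show ?thesis using ks by simp
      next
        case False
        then show ?thesis
          using ideal_zero[OF I] by (simp add: r_def)
      qed
      then have "(\<Sum>k<L. (if k \<le> s then g (s - k) * w k else 0) - (\<Sum>x\<in>C. r k x)) \<in> I"
        by (intro ideal_sum[OF I])
      then show ?thesis
        by (simp add: sum_subtractf r0)
    qed
    have "w i \<in> I" if "i < L" for i
    proof (rule mccoy[where I = I and M = ?S and g = g and m = m and L = L])
      show "g i * f \<in> I" if "f \<in> I" for i f
        using ideal_mult[OF I g that] .
      show "g i * f \<in> ?S" if "f \<in> ?S" for i f
        using that g by (intro carrier_mult)
    qed (use g0 regular wS conv that ideal_zero[OF I] ideal_diff[OF I] in \<open>auto simp: graded_part_def\<close>)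
    \<comment> \<open>All coefficients of \<open>w\<close> lie in \<open>I\<close>, so independence
      of \<open>C\<close> modulo \<open>I\<close> contradicts the nontrivial solution.\<close>
    then have "c (i, x) = 0" if "i < L" "x \<in> C" for i x
      using C_indep[of "\<lambda>x. c (i, x)" x] that wS[of i] by (auto simp: w_def graded_part_def)
    with c0 show False by auto
  qed
  with C(3) D(3) show ?thesis by linarith
qed

section \<open>The lower bound for the degree\<close>

lemma dim_graded_part_mono:
  fixes I J :: "'k::field mpoly set"
  assumes "finite V" "ideal I (poly_ring V)" "ideal J (poly_ring V)" "I \<subseteq> J"
  shows "mpoly.dim (graded_part t I) \<le> mpoly.dim (graded_part t J)"
proof -
  have "graded_part t J \<subseteq> mpoly.span ((\<lambda>a. single a 1) ` monomials V t)"
    using graded_part_mono[OF ideal_subset[OF assms(3)]] graded_part_span by blast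
  from finite_imageI[OF finite_monomials[OF assms(1)]] this subspace_graded_part[OF assms(2)]
    graded_part_mono[OF assms(4)]
  show ?thesis
    by (rule mpoly.relative_basis_obtain) linarith
qed

text \<open>Multiply \<open>f\<close> by the product of the variables in \<open>B\<close> and let
  \<open>B\<close> shrink from \<open>V\<close> to the empty set, using saturation each time: a
  further variable either is in \<open>B\<close> and gets squared, or enlarges
  \<open>B\<close>.\<close>

lemma saturated_squares:
  assumes V: "finite V" and I: "ideal I (poly_ring V)" and sat: "saturated V I"
    and f: "f \<in> carrier (poly_ring V)" and sq: "\<And>v. v \<in> V \<Longrightarrow> var v * var v * f \<in> I"
  shows "f \<in> I"
proof -
  have "(\<Prod>v\<in>B. var v) * f \<in> I" if "B \<subseteq> V" for B
    using that
  proof (induction "card (V - B)" arbitrary: B rule: less_induct)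
    case less
    have B: "finite B" using less.prems V finite_subset by blast
    have prod: "(\<Prod>v\<in>A. var v) \<in> carrier (poly_ring V)" if "A \<subseteq> V" for A
      using finite_subset[OF that V] that
      by (induction A rule: finite_induct)
        (auto simp: carrier_mult var_in_carrier in_carrier_iff[of 1])
    have "var v * ((\<Prod>v\<in>B. var v) * f) \<in> I" if v: "v \<in> V" for v
    proof (cases "v \<in> B")
      case True
      have "(\<Prod>v\<in>B - {v}. var v) * (var v * var v * f) \<in> I"
        using less.prems by (intro ideal_mult[OF I prod sq[OF v]]) auto
      also have "(\<Prod>v\<in>B - {v}. var v) * (var v * var v * f) = var v * ((\<Prod>v\<in>B. var v) * f)"
        by (simp only: prod.remove[OF B True] mult_ac)
      finally show ?thesis .
    next
      case False
      have "card (V - insert v B) < card (V - B)"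
        using False v V by (intro psubset_card_mono) auto
      then have "(\<Prod>v\<in>insert v B. var v) * f \<in> I"
        using less v by simp
      then show ?thesis using False B by (simp add: mult_ac)
    qed
    moreover have "(\<Prod>v\<in>B. var v) * f \<in> carrier (poly_ring V)"
      by (intro carrier_mult prod less.prems f)
    ultimately show ?case
      using sat unfolding saturated_def by blast
  qed
  from this[of "{}"] show ?thesis by simp
qed

text \<open>
  Modulo \<open>I\<close>, a general combination \<open>g\<close> of the squares of the variables is a nonzerodivisor, and
  the quotient by \<open>I + (g)\<close>, which surjects onto the quotient by \<open>J\<close>, has length \<open>2 d\<close>.
\<close>

lemma length_le_twice_degree:
  fixes I J :: "'k::field mpoly set"
  assumes V: "finite V" and I: "closed_subscheme_ideal V I" and d: "has_degree V I d"
    and J: "ideal J (poly_ring V)" and IJ: "I \<subseteq> J" and sq: "\<And>v. v \<in> V \<Longrightarrow> var v * var v \<in> J"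
  shows "(\<Sum>t\<le>T. hilbert_function V J t) \<le> 2 * d"
proof -
  let ?S = "carrier (poly_ring V) :: 'k mpoly set"
  have idI: "ideal I (poly_ring V)" and sat: "saturated V I"
    using I by (auto simp: closed_subscheme_ideal_def homogeneous_ideal_def)
  define s where "s t = mpoly.dim (graded_part t ?S)" for t
  define i where "i t = mpoly.dim (graded_part t I)" for t
  define j where "j t = mpoly.dim (graded_part t J)" for t
  have h: "hilbert_function V I t = s t - i t" "hilbert_function V J t = s t - j t" for t
    by (simp_all add: hilbert_function_eq s_def i_def j_def)
  have le: "i t \<le> j t" "j t \<le> s t" for t
    unfolding i_def j_def s_def
    by (rule dim_graded_part_mono[OF V idI J IJ],
        rule dim_graded_part_mono[OF V J ideal_carrier ideal_subset[OF J]])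
  obtain e where e: "bij_betw e {..<card V} V"
    using ex_bij_betw_nat_finite[OF V] by (auto simp: atLeast0LessThan)
  \<comment> \<open>The squares are the coefficients of the successive powers of T; the value 0 from
    \<open>card V\<close> on keeps this a polynomial.\<close>
  define g :: "nat \<Rightarrow> 'k mpoly" where "g k = (if k < card V then var (e k) * var (e k) else 0)" for k
  have ev: "e k \<in> V" if "k < card V" for k
    using e that by (auto simp: bij_betw_def)
  have gS: "g k \<in> ?S" for k
    using ev by (auto simp: g_def carrier_zero intro!: carrier_mult var_in_carrier)
  have gJ: "g k \<in> J" for k
    using ev sq ideal_zero[OF J] by (auto simp: g_def)
  have hg: "homogeneous 2 (g k)" for k
    by (auto simp: g_def var_def mult_single monom_degree_add intro!: homogeneous_single)
  \<comment> \<open>In terms of Hilbert functions H_J(t+2) \<le> H_I(t+2) - H_I(t), since every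
    \<open>g k\<close> has degree 2 and lies in \<open>J\<close>.\<close>
  have key: "s t + i (t + 2) \<le> j (t + 2) + i t" for t
    unfolding s_def i_def j_def
  proof (rule mult_dim_le[where g = g and m = "card V"])
    show "f \<in> I" if f: "f \<in> ?S" and gf: "\<And>k. g k * f \<in> I" for f
    proof (rule saturated_squares[OF V idI sat f])
      fix v assume "v \<in> V"
      then obtain k where "k < card V" "e k = v"
        using e unfolding bij_betw_def by (metis imageE lessThan_iff)
      then show "var v * var v * f \<in> I"
        using gf[of k] by (simp add: g_def)
    qed
    show "g k * f \<in> graded_part (t + 2) J" if "f \<in> graded_part t ?S" for k f
    proof -
      have "f * g k \<in> J"
        using that by (intro ideal_mult[OF J _ gJ]) (simp add: graded_part_def)
      moreover have "homogeneous (t + 2) (f * g k)"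
        using that by (intro homogeneous_mult hg) (simp add: graded_part_def)
      ultimately show ?thesis
        by (simp add: graded_part_def mult.commute)
    qed
    show "graded_part (t + 2) I \<subseteq> graded_part (t + 2) J"
      by (rule graded_part_mono[OF IJ])
    show "graded_part (t + 2) J \<subseteq> graded_part (t + 2) ?S"
      by (rule graded_part_mono[OF ideal_subset[OF J]])
    show "g k = 0" if "k \<ge> card V" for k
      using that by (simp add: g_def)
  qed (fact V idI gS subspace_graded_part[OF J])+
  \<comment> \<open>The differences telescope in steps of two, so only the last two values of H_I
    survive; degrees 0 and 1 have nothing to subtract.\<close>
  have step: "(\<Sum>t\<le>Suc k. s t - j t) \<le> (s k - i k) + (s (Suc k) - i (Suc k))" for k
  proof (induction k)
    case 0
    then show ?case using le[of 0] le[of 1] by simp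
  next
    case (Suc k)
    have "s k + i (Suc (Suc k)) \<le> j (Suc (Suc k)) + i k"
      using key[of k] by simp
    then show ?case
      using Suc le[of k] le[of "Suc (Suc k)"] by simp
  qed
  obtain N where N: "\<And>t. t \<ge> N \<Longrightarrow> s t - i t = d"
    using d unfolding has_degree_def h eventually_sequentially by blast
  \<comment> \<open>Beyond \<open>N\<close> both surviving values are \<open>d\<close>; taking the
    maximum with \<open>T\<close> keeps the whole sum covered.\<close>
  have "(\<Sum>t\<le>T. s t - j t) \<le> (\<Sum>t\<le>Suc (max N T). s t - j t)"
    by (rule sum_mono2) auto
  also have "\<dots> \<le> 2 * d"
    using step[of "max N T"] N[of "max N T"] N[of "Suc (max N T)"] by simp
  finally show ?thesis by (simp add: h)
qed

section \<open>Vertex degrees and matchings\<close>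

text \<open>
  Monomials are multigraphs on the vertices \<open>1, \<dots>, 2n\<close>, the variable \<open>(i, j)\<close> being an edge. The
  loop \<open>(1, 1)\<close> is not counted: it is the homogenizing variable of the upper bound.
\<close>

definition vdeg :: "monom \<Rightarrow> nat \<Rightarrow> nat" where
  "vdeg m i = (\<Sum>v\<in>keys m - {(1, 1)}. lookup m v * (of_bool (fst v = i) + of_bool (snd v = i)))"

text \<open>These are the monomials of x_11^j Hf: a perfect matching times the \<open>j\<close>-th
  power of the uncounted loop. Other loops are excluded because they give a vertex degree 2.\<close>

definition perfect :: "nat \<Rightarrow> nat \<Rightarrow> monom \<Rightarrow> bool" where
  "perfect n j b \<longleftrightarrow> keys b \<subseteq> sym_vars n \<and> lookup b (1, 1) = j \<and> (\<forall>i. vdeg b i = of_bool (i \<in> {1..2 * n}))"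

lemma vdeg_superset:
  assumes "finite A" "keys m \<subseteq> A"
  shows "vdeg m i = (\<Sum>v\<in>A - {(1, 1)}. lookup m v * (of_bool (fst v = i) + of_bool (snd v = i)))"
  unfolding vdeg_def using assms by (intro sum.mono_neutral_left) (auto simp: in_keys_iff)

lemma vdeg_add: "vdeg (a + b) i = vdeg a i + vdeg b i"
proof -
  let ?A = "keys a \<union> keys b"
  have "vdeg c i = (\<Sum>v\<in>?A - {(1, 1)}. lookup c v * (of_bool (fst v = i) + of_bool (snd v = i)))"
    if "keys c \<subseteq> ?A" for c
    using that by (intro vdeg_superset) auto
  then show ?thesis
    by (simp add: keys_plus_monom lookup_add sum.distrib algebra_simps)
qed

lemma vdeg_zero [simp]: "vdeg 0 i = 0"
  by (simp add: vdeg_def)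

lemma vdeg_single:
  "vdeg (single v k) i = (if v = (1, 1) then 0 else k * (of_bool (fst v = i) + of_bool (snd v = i)))"
proof -
  have "{v} - {(1, 1)} = (if v = (1, 1) then {} else {v})" by auto
  then show ?thesis
    using vdeg_superset[of "{v}" "single v k" i] by (simp del: One_nat_def)
qed

lemma vdeg_sum: "vdeg (sum f A) i = (\<Sum>x\<in>A. vdeg (f x) i)"
  by (induction A rule: infinite_finite_induct) (auto simp: vdeg_add)

lemma keys_sum_monom: "finite A \<Longrightarrow> keys (sum f A :: monom) = (\<Union>x\<in>A. keys (f x))"
  by (induction A rule: finite_induct) (auto simp: keys_plus_monom)

lemma monom_decompose: "v \<in> keys (a :: monom) \<Longrightarrow> \<exists>b. a = single v 1 + b"
  by (intro exI[of _ "a - single v 1"] poly_mapping_eqI)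
    (auto simp: lookup_add lookup_minus lookup_single in_keys_iff when_def)

lemma monom_expand: "a = (\<Sum>v\<in>keys a. single v (lookup a v))" for a :: monom
  by (rule poly_mapping_eqI) (auto simp: lookup_sum lookup_single when_def in_keys_iff)

text \<open>Handshake count: each edge has two ends, and the second summand restores the loop that
  \<open>vdeg\<close> ignores.\<close>

lemma vdeg_sum_eq:
  assumes "keys a \<subseteq> sym_vars n"
  shows "(\<Sum>i\<in>{1..2 * n}. vdeg a i) + 2 * lookup a (1, 1) = 2 * monom_degree a"
proof -
  have *: "(\<Sum>i\<in>{1..2 * n}. vdeg (single v k) i) + 2 * lookup (single v k) (1, 1) = 2 * k"
    if "v \<in> sym_vars n" for v k
  proof (cases "v = (1, 1)")
    case True
    then show ?thesis by (simp add: vdeg_single)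
  next
    case False
    have "(\<Sum>i\<in>{1..2 * n}. of_bool (fst v = i) :: nat) = 1" "(\<Sum>i\<in>{1..2 * n}. of_bool (snd v = i) :: nat) = 1"
      using that by (auto simp: sym_vars_def of_bool_def)
    then show ?thesis
      using False by (simp add: vdeg_single sum.distrib lookup_single when_def
          flip: sum_distrib_left)
  qed
  have "(\<Sum>i\<in>{1..2 * n}. vdeg a i) + 2 * lookup a (1, 1)
    = (\<Sum>v\<in>keys a. (\<Sum>i\<in>{1..2 * n}. vdeg (single v (lookup a v)) i) + 2 * lookup (single v (lookup a v)) (1, 1))"
  proof -
    have "vdeg a i = (\<Sum>v\<in>keys a. vdeg (single v (lookup a v)) i)" for i
      using arg_cong[OF monom_expand[of a], of "\<lambda>b. vdeg b i"] unfolding vdeg_sum .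
    then have "(\<Sum>i\<in>{1..2 * n}. vdeg a i) = (\<Sum>v\<in>keys a. \<Sum>i\<in>{1..2 * n}. vdeg (single v (lookup a v)) i)"
      by (simp only:) (rule sum.swap)
    moreover have "lookup a (1, 1) = (\<Sum>v\<in>keys a. lookup (single v (lookup a v)) (1, 1))"
      using arg_cong[OF monom_expand[of a], of "\<lambda>b. lookup b (1, 1)"] unfolding lookup_sum .
    ultimately show ?thesis
      by (simp only: sum.distrib sum_distrib_left)
  qed
  also have "\<dots> = (\<Sum>v\<in>keys a. 2 * lookup a v)"
    using assms by (intro sum.cong refl *) auto
  finally show ?thesis
    by (simp add: monom_degree_def sum_distrib_left)
qed

lemma vdeg_ge:
  assumes "v \<in> keys a" "v \<noteq> (1, 1)"
  shows "lookup a v * (of_bool (fst v = i) + of_bool (snd v = i)) \<le> vdeg a i"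
  unfolding vdeg_def by (rule member_le_sum) (use assms in auto)

lemma vdeg_pos_obtain:
  assumes "vdeg a i \<noteq> 0"
  obtains v where "v \<in> keys a" "v \<noteq> (1, 1)" "fst v = i \<or> snd v = i"
proof -
  obtain v where "v \<in> keys a - {(1, 1)}"
    "lookup a v * (of_bool (fst v = i) + of_bool (snd v = i)) \<noteq> 0"
    using assms unfolding vdeg_def by (rule sum.not_neutral_contains_not_neutral)
  then show thesis
    by (intro that[of v]) (auto split: if_splits)
qed

text \<open>Pairs off two vertices at a time. Such matchings serve as members of the classes below
  and, on complements, as the monomials that test them.\<close>

lemma matching_exists:
  assumes "finite U" "card U = 2 * k"
  shows "\<exists>m. keys m \<subseteq> {(i, j). i \<in> U \<and> j \<in> U \<and> i < j} \<and> (\<forall>i. vdeg m i = of_bool (i \<in> U)) \<and> monom_degree m = k"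
  using assms
proof (induction k arbitrary: U)
  case 0
  then show ?case by (intro exI[of _ 0]) simp
next
  case (Suc k)
  then have "card U > 1" by simp
  then obtain p q where pq: "p \<in> U" "q \<in> U" "p < q"
    using card_le_Suc0_iff_eq[OF Suc.prems(1)] by (metis One_nat_def linorder_neqE_nat not_less)
  have "card (U - {p, q}) = 2 * k"
    using Suc.prems pq by (simp add: card_Diff_subset)
  then obtain m where m: "keys m \<subseteq> {(i, j). i \<in> U - {p, q} \<and> j \<in> U - {p, q} \<and> i < j}"
    "\<And>i. vdeg m i = of_bool (i \<in> U - {p, q})" "monom_degree m = k"
    using Suc.IH[of "U - {p, q}"] Suc.prems(1) by auto
  show ?case
  proof (intro exI[of _ "single (p, q) 1 + m"] conjI allI)
    show "keys (single (p, q) 1 + m) \<subseteq> {(i, j). i \<in> U \<and> j \<in> U \<and> i < j}"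
      using m(1) pq by (auto simp: keys_plus_monom)
    show "vdeg (single (p, q) 1 + m) i = of_bool (i \<in> U)" for i
      using pq by (auto simp: vdeg_add vdeg_single m(2))
    show "monom_degree (single (p, q) 1 + m) = Suc k"
      by (simp add: monom_degree_add m(3))
  qed
qed

section \<open>The coefficients of the Hafnian\<close>

lemma sum_odd_even: "(\<Sum>k=1..2 * n. h k) = (\<Sum>i=1..n. h (2 * i - 1) + h (2 * i :: nat) :: 'a::comm_monoid_add)"
proof (induction n)
  case (Suc n)
  have "{1..2 * Suc n} = insert (2 * n + 2) (insert (2 * n + 1) {1..2 * n})" by auto
  then show ?case using Suc by (simp add: add_ac)
qed simp

lemma strict_enumeration_unique:
  fixes f g :: "nat \<Rightarrow> nat"
  assumes "\<And>i j. 1 \<le> i \<Longrightarrow> i < j \<Longrightarrow> j \<le> n \<Longrightarrow> f i < f j"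
    and "\<And>i j. 1 \<le> i \<Longrightarrow> i < j \<Longrightarrow> j \<le> n \<Longrightarrow> g i < g j"
    and "f ` {1..n} = g ` {1..n}" and "1 \<le> i" "i \<le> n"
  shows "f i = g i"
proof -
  have sorted: "sorted_wrt (<) (map h [1..<Suc n])" if "\<And>i j. 1 \<le> i \<Longrightarrow> i < j \<Longrightarrow> j \<le> n \<Longrightarrow> h i < h j"
    for h :: "nat \<Rightarrow> nat"
    using that by (auto simp: sorted_wrt_iff_nth_less simp del: upt_Suc)
  have set: "set (map h [1..<Suc n]) = h ` {1..n}" for h :: "nat \<Rightarrow> nat"
    by (auto simp: atLeastLessThanSuc_atLeastAtMost simp del: upt_Suc)
  have "map f [1..<Suc n] = map g [1..<Suc n]"
    using sorted[OF assms(1)] sorted[OF assms(2)] assms(3)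
    by (intro strict_sorted_equal) (simp_all only: set)
  then show ?thesis
    using assms(4,5) by (simp del: upt_Suc)
qed

definition hafnian_monom :: "nat \<Rightarrow> (nat \<Rightarrow> nat) \<Rightarrow> monom" where
  "hafnian_monom n \<sigma> = (\<Sum>i=1..n. single (\<sigma> (2 * i - 1), \<sigma> (2 * i)) 1)"

lemma prod_single: "(\<Prod>x\<in>A. single (f x) 1) = single (\<Sum>x\<in>A. f x) (1 :: 'b::comm_semiring_1)"
  by (induction A rule: infinite_finite_induct) (auto simp: mult_single)

lemma
  assumes "\<sigma> \<in> hafnian_perms n"
  shows hafnian_perms_permutes: "\<sigma> permutes {1..2 * n}"
    and hafnian_perms_pair: "\<And>i. 1 \<le> i \<Longrightarrow> i \<le> n \<Longrightarrow> \<sigma> (2 * i - 1) < \<sigma> (2 * i)"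
    and hafnian_perms_mono: "\<And>i j. 1 \<le> i \<Longrightarrow> i < j \<Longrightarrow> j \<le> n \<Longrightarrow> \<sigma> (2 * i - 1) < \<sigma> (2 * j - 1)"
proof -
  show "\<sigma> permutes {1..2 * n}" "\<And>i. 1 \<le> i \<Longrightarrow> i \<le> n \<Longrightarrow> \<sigma> (2 * i - 1) < \<sigma> (2 * i)"
    using assms by (auto simp: hafnian_perms_def)
  fix i j assume i: "1 \<le> i" and "i < j" "j \<le> n"
  from \<open>i < j\<close> have "i + 1 \<le> j" by simp
  then show "\<sigma> (2 * i - 1) < \<sigma> (2 * j - 1)" using \<open>j \<le> n\<close>
  proof (induction j rule: dec_induct)
    case base
    then show ?case using assms i by (auto simp: hafnian_perms_def)
  next
    case (step j)
    moreover have "\<sigma> (2 * j - 1) < \<sigma> (2 * j + 1)"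
      using assms i step by (auto simp: hafnian_perms_def)
    ultimately show ?case by simp
  qed
qed

lemma keys_hafnian_monom: "keys (hafnian_monom n \<sigma>) = (\<lambda>i. (\<sigma> (2 * i - 1), \<sigma> (2 * i))) ` {1..n}"
  by (auto simp: hafnian_monom_def keys_sum_monom)

lemma perfect_hafnian_monom:
  assumes "\<sigma> \<in> hafnian_perms n"
  shows "perfect n 0 (hafnian_monom n \<sigma>)"
  unfolding perfect_def
proof (intro conjI allI)
  note perm = hafnian_perms_permutes[OF assms] and pair = hafnian_perms_pair[OF assms]
  have range: "\<sigma> k \<in> {1..2 * n}" if "k \<in> {1..2 * n}" for k
    using permutes_in_image[OF perm] that by blast
  show "keys (hafnian_monom n \<sigma>) \<subseteq> sym_vars n"
  proof -
    have "(\<sigma> (2 * i - 1), \<sigma> (2 * i)) \<in> sym_vars n" if "i \<in> {1..n}" for i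
    proof -
      have "2 * i - 1 \<in> {1..2 * n}" "2 * i \<in> {1..2 * n}" using that by auto
      from this[THEN range] show ?thesis
        using that pair[of i] by (auto simp: sym_vars_def)
    qed
    then show ?thesis by (auto simp: keys_hafnian_monom)
  qed
  have not11: "(\<sigma> (2 * i - 1), \<sigma> (2 * i)) \<noteq> (1, 1)" if "i \<in> {1..n}" for i
    using pair[of i] that by auto
  then have "(1, 1) \<notin> keys (hafnian_monom n \<sigma>)"
    by (metis (no_types, lifting) imageE keys_hafnian_monom)
  then show "lookup (hafnian_monom n \<sigma>) (1, 1) = 0"
    by (simp add: in_keys_iff)
  fix i
  have "vdeg (hafnian_monom n \<sigma>) i = (\<Sum>k=1..n. of_bool (\<sigma> (2 * k - 1) = i) + of_bool (\<sigma> (2 * k) = i))"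
    unfolding hafnian_monom_def vdeg_sum
  proof (rule sum.cong[OF refl])
    fix k assume "k \<in> {1..n}"
    from not11[OF this]
    show "vdeg (single (\<sigma> (2 * k - 1), \<sigma> (2 * k)) 1) i = of_bool (\<sigma> (2 * k - 1) = i) + of_bool (\<sigma> (2 * k) = i)"
      by (simp only: vdeg_single if_False fst_conv snd_conv mult_1)
  qed
  also have "\<dots> = (\<Sum>k=1..2 * n. of_bool (\<sigma> k = i))"
    by (rule sum_odd_even[symmetric])
  also have "\<dots> = (\<Sum>k\<in>\<sigma> ` {1..2 * n}. of_bool (k = i))"
    by (subst sum.reindex[OF permutes_inj_on[OF perm]]) simp
  also have "\<dots> = of_bool (i \<in> {1..2 * n})"
    unfolding permutes_image[OF perm] by (auto simp: of_bool_def)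
  finally show "vdeg (hafnian_monom n \<sigma>) i = of_bool (i \<in> {1..2 * n})" .
qed

text \<open>The lower endpoints enumerate the same set increasingly, so they agree; an edge is
  determined by its lower endpoint, so the upper ones agree too.\<close>

lemma inj_on_hafnian_monom: "inj_on (hafnian_monom n) (hafnian_perms n)"
proof (rule inj_onI)
  fix \<sigma> \<tau> assume \<sigma>: "\<sigma> \<in> hafnian_perms n" and \<tau>: "\<tau> \<in> hafnian_perms n"
    and eq: "hafnian_monom n \<sigma> = hafnian_monom n \<tau>"
  have keys: "(\<lambda>i. (\<sigma> (2 * i - 1), \<sigma> (2 * i))) ` {1..n} = (\<lambda>i. (\<tau> (2 * i - 1), \<tau> (2 * i))) ` {1..n}"
    using eq by (metis keys_hafnian_monom)
  have "(\<lambda>i. \<sigma> (2 * i - 1)) ` {1..n} = (\<lambda>i. \<tau> (2 * i - 1)) ` {1..n}"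
    using arg_cong[OF keys, of "image fst"] by (simp add: image_image)
  then have odd: "\<sigma> (2 * i - 1) = \<tau> (2 * i - 1)" if "1 \<le> i" "i \<le> n" for i
    using strict_enumeration_unique[of n "\<lambda>i. \<sigma> (2 * i - 1)" "\<lambda>i. \<tau> (2 * i - 1)" i]
      hafnian_perms_mono[OF \<sigma>] hafnian_perms_mono[OF \<tau>] that by blast
  have even: "\<sigma> (2 * i) = \<tau> (2 * i)" if i: "1 \<le> i" "i \<le> n" for i
  proof -
    have "(\<sigma> (2 * i - 1), \<sigma> (2 * i)) \<in> (\<lambda>i. (\<tau> (2 * i - 1), \<tau> (2 * i))) ` {1..n}"
      unfolding keys[symmetric] using i by (intro imageI) simp
    then obtain j where j: "j \<in> {1..n}" "\<sigma> (2 * i - 1) = \<tau> (2 * j - 1)" "\<sigma> (2 * i) = \<tau> (2 * j)"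
      by blast
    then have "j = i"
      using hafnian_perms_mono[OF \<tau>, of i j] hafnian_perms_mono[OF \<tau>, of j i] odd[OF i] i
      by (metis atLeastAtMost_iff linorder_neqE_nat order_less_irrefl)
    then show ?thesis using j by simp
  qed
  show "\<sigma> = \<tau>"
  proof
    fix k
    show "\<sigma> k = \<tau> k"
    proof (cases "k \<in> {1..2 * n}")
      case False
      then show ?thesis
        using hafnian_perms_permutes[OF \<sigma>] hafnian_perms_permutes[OF \<tau>] by (metis permutes_not_in)
    next
      case True
      show ?thesis
      proof (cases "even k")
        case True
        then show ?thesis using \<open>k \<in> {1..2 * n}\<close> even[of "k div 2"] by auto
      next
        case False
        then have "2 * ((k + 1) div 2) - 1 = k" by presburger
        then show ?thesis using \<open>k \<in> {1..2 * n}\<close> odd[of "(k + 1) div 2"] by auto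
      qed
    qed
  qed
qed

text \<open>A loop, a repeated edge or two edges sharing a vertex would push some vertex degree to
  2.\<close>

lemma perfect_keys:
  assumes b: "perfect n 0 b" and v: "v \<in> keys b"
  shows "fst v < snd v" "snd v \<le> 2 * n" "1 \<le> fst v" "lookup b v = 1"
    and "w \<in> keys b \<Longrightarrow> {fst v, snd v} \<inter> {fst w, snd w} \<noteq> {} \<Longrightarrow> w = v"
proof -
  have keys: "keys b \<subseteq> sym_vars n" and v0: "(1, 1) \<notin> keys b"
    and deg: "\<And>i. vdeg b i \<le> 1"
    using b by (auto simp: perfect_def in_keys_iff)
  have v1: "v \<noteq> (1, 1)" using v v0 by blast
  have bv: "lookup b v > 0" using v by (simp add: in_keys_iff)
  have le: "lookup b v * (of_bool (fst v = i) + of_bool (snd v = i)) \<le> 1" for i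
    using vdeg_ge[OF v v1, of i] deg[of i] by linarith
  have "v \<in> sym_vars n" using v keys by blast
  then have sv: "1 \<le> fst v" "fst v \<le> snd v" "snd v \<le> 2 * n"
    by (auto simp: sym_vars_def)
  have ne: "fst v \<noteq> snd v"
    using le[of "fst v"] bv by auto
  show "fst v < snd v" "snd v \<le> 2 * n" "1 \<le> fst v" using sv ne by auto
  show "lookup b v = 1" using le[of "fst v"] bv ne by simp
  show "w = v" if w: "w \<in> keys b" and meet: "{fst v, snd v} \<inter> {fst w, snd w} \<noteq> {}"
  proof (rule ccontr)
    assume "w \<noteq> v"
    obtain i where i: "fst v = i \<or> snd v = i" "fst w = i \<or> snd w = i" using meet by auto
    obtain c where c: "b = single v 1 + c" using monom_decompose[OF v] by blast
    have "w \<in> keys c" using w \<open>w \<noteq> v\<close> by (auto simp: c keys_plus_monom)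
    moreover have "w \<noteq> (1, 1)" using w v0 by blast
    ultimately have "lookup c w * (of_bool (fst w = i) + of_bool (snd w = i)) \<le> vdeg c i"
      by (rule vdeg_ge)
    then have "vdeg c i \<ge> 1"
      using i \<open>w \<in> keys c\<close> by (auto simp: in_keys_iff)
    moreover have "vdeg (single v 1) i \<ge> 1"
      using i v1 by (auto simp: vdeg_single)
    ultimately show False
      using deg[of i] by (simp add: c vdeg_add)
  qed
qed

text \<open>Sort the edges of the matching by lower endpoint and read off their ends in turn: this
  is the permutation.\<close>

lemma hafnian_monom_surj:
  assumes b: "perfect n 0 b"
  shows "\<exists>\<sigma>\<in>hafnian_perms n. hafnian_monom n \<sigma> = b"
proof -
  note pk = perfect_keys[OF b]
  have inj: "inj_on fst (keys b)"
    by (rule inj_onI) (rule pk(5), auto)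
  have b1: "b = (\<Sum>v\<in>keys b. single v 1)"
    by (subst monom_expand) (simp add: pk(4))
  have "monom_degree b = n"
    using b vdeg_sum_eq[of b n] by (simp add: perfect_def)
  then have "card (keys b) = n"
    by (simp add: monom_degree_def pk(4))
  define l where "l = sorted_list_of_set (fst ` keys b)"
  have l: "sorted_wrt (<) l" "set l = fst ` keys b" "length l = n"
    using \<open>card (keys b) = n\<close> by (simp_all add: l_def strict_sorted_iff card_image[OF inj])
  \<comment> \<open>Edges are numbered from 1, list positions from 0.\<close>
  define f where "f i = l ! (i - 1)" for i
  have f_mono: "f i < f j" if "1 \<le> i" "i < j" "j \<le> n" for i j
    using l that by (auto simp: f_def sorted_wrt_iff_nth_less)
  have f_image: "f ` {1..n} = fst ` keys b"
  proof -
    have "f ` {1..n} = (!) l ` {..<n}"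
      unfolding f_def image_Suc_lessThan[symmetric] image_image by simp
    then show ?thesis using l(2,3) by (auto simp: set_conv_nth)
  qed
  have "\<forall>i\<in>{1..n}. \<exists>y. (f i, y) \<in> keys b"
  proof
    fix i assume "i \<in> {1..n}"
    then have "f i \<in> fst ` keys b" using f_image by blast
    then show "\<exists>y. (f i, y) \<in> keys b" by force
  qed
  from bchoice[OF this] obtain g where "\<forall>i\<in>{1..n}. (f i, g i) \<in> keys b" ..
  then have g: "(f i, g i) \<in> keys b" if "i \<in> {1..n}" for i
    using that by (rule bspec)
  have f_inj: "inj_on f {1..n}"
  proof (rule inj_onI)
    fix i j assume "i \<in> {1..n}" "j \<in> {1..n}" "f i = f j"
    then show "i = j"
      using f_mono[of i j] f_mono[of j i] by (cases i j rule: linorder_cases) auto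
  qed
  have pairs_inj: "inj_on (\<lambda>i. (f i, g i)) {1..n}"
    by (rule inj_on_imageI2[of fst]) (use f_inj in \<open>simp add: comp_def\<close>)
  have pairs: "(\<lambda>i. (f i, g i)) ` {1..n} = keys b"
  proof (rule card_subset_eq)
    show "card ((\<lambda>i. (f i, g i)) ` {1..n}) = card (keys b)"
      unfolding card_image[OF pairs_inj] using \<open>card (keys b) = n\<close> by simp
  qed (use g in auto)
  \<comment> \<open>Edge \<open>i\<close> fills the positions \<open>2 * i - 1\<close> and
    \<open>2 * i\<close>; the identity elsewhere is what \<open>permutes\<close> demands.\<close>
  define \<sigma> where "\<sigma> k = (if k \<in> {1..2 * n} then if odd k then f ((k + 1) div 2) else g (k div 2) else k)" for k
  have \<sigma>: "\<sigma> (2 * i - 1) = f i" "\<sigma> (2 * i) = g i" if "1 \<le> i" "i \<le> n" for i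
  proof -
    have "odd (2 * i - 1)" "(2 * i - 1 + 1) div 2 = i" using that by presburger+
    then show "\<sigma> (2 * i - 1) = f i" using that unfolding \<sigma>_def by auto
  qed (use that in \<open>auto simp: \<sigma>_def\<close>)
  have "\<sigma> ` {1..2 * n} = {1..2 * n}"
  proof (intro equalityI subsetI)
    fix x assume "x \<in> \<sigma> ` {1..2 * n}"
    then obtain k where k: "k \<in> {1..2 * n}" "x = \<sigma> k" by blast
    define i where "i = (k + 1) div 2"
    have i: "i \<in> {1..n}" using k(1) by (auto simp: i_def)
    have "x = f i \<or> x = g i"
      using k by (auto simp: \<sigma>_def i_def elim!: evenE)
    then show "x \<in> {1..2 * n}"
      using pk(1-3)[OF g[OF i]] by auto
  next
    fix x assume x: "x \<in> {1..2 * n}"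
    then have "vdeg b x \<noteq> 0" using b by (simp add: perfect_def)
    then obtain v where "v \<in> keys b" "fst v = x \<or> snd v = x"
      by (rule vdeg_pos_obtain)
    then obtain i where i: "i \<in> {1..n}" "f i = x \<or> g i = x"
      unfolding pairs[symmetric] by force
    then have "\<sigma> (2 * i - 1) = x \<or> \<sigma> (2 * i) = x"
      using \<sigma>[of i] by auto
    moreover have "2 * i - 1 \<in> {1..2 * n}" "2 * i \<in> {1..2 * n}" using i(1) by auto
    ultimately show "x \<in> \<sigma> ` {1..2 * n}" by (metis imageI)
  qed
  then have "bij_betw \<sigma> {1..2 * n} {1..2 * n}"
    by (simp add: bij_betw_def eq_card_imp_inj_on)
  then have "\<sigma> permutes {1..2 * n}"
    by (rule bij_imp_permutes) (auto simp: \<sigma>_def)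
  moreover have "\<sigma> (2 * i - 1) < \<sigma> (2 * i + 1)" if "i \<in> {1..<n}" for i
    using that \<sigma>(1)[of i] \<sigma>(1)[of "i + 1"] f_mono[of i "i + 1"] by simp
  moreover have "\<sigma> (2 * i - 1) < \<sigma> (2 * i)" if "i \<in> {1..n}" for i
    using that \<sigma>[of i] pk(1)[OF g[OF that]] by simp
  ultimately have "\<sigma> \<in> hafnian_perms n"
    by (simp add: hafnian_perms_def)
  moreover have "hafnian_monom n \<sigma> = (\<Sum>i=1..n. single (f i, g i) 1)"
    unfolding hafnian_monom_def using \<sigma> by (intro sum.cong) auto
  then have "hafnian_monom n \<sigma> = (\<Sum>v\<in>(\<lambda>i. (f i, g i)) ` {1..n}. single v 1)"
    unfolding sum.reindex[OF pairs_inj] comp_def .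
  then have "hafnian_monom n \<sigma> = b"
    unfolding pairs using b1 by simp
  ultimately show ?thesis by blast
qed

text \<open>Distinct permutations give distinct monomials and every perfect matching occurs, so the
  coefficients are 0 and 1.\<close>

lemma lookup_hafnian: "lookup (hafnian n :: 'k::field mpoly) b = of_bool (perfect n 0 b)"
proof -
  have fin: "finite (hafnian_perms n)"
    using finite_permutations[of "{1..2 * n}"] by (rule rev_finite_subset) (auto simp: hafnian_perms_def)
  have "hafnian n = (\<Sum>\<sigma>\<in>hafnian_perms n. single (hafnian_monom n \<sigma>) (1 :: 'k))"
    unfolding hafnian_def
  proof (rule sum.cong[OF refl])
    fix \<sigma> assume "\<sigma> \<in> hafnian_perms n"
    note pair = hafnian_perms_pair[OF this]
    have "(\<Prod>i=1..n. sym_entry (\<sigma> (2 * i - 1)) (\<sigma> (2 * i)))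
      = (\<Prod>i=1..n. single (single (\<sigma> (2 * i - 1), \<sigma> (2 * i)) 1) (1 :: 'k))"
    proof (rule prod.cong[OF refl])
      fix i assume "i \<in> {1..n}"
      then have "\<sigma> (2 * i - 1) < \<sigma> (2 * i)" using pair by simp
      then show "sym_entry (\<sigma> (2 * i - 1)) (\<sigma> (2 * i)) = single (single (\<sigma> (2 * i - 1), \<sigma> (2 * i)) 1) (1 :: 'k)"
        by (simp add: sym_entry_def var_def)
    qed
    then show "(\<Prod>i=1..n. sym_entry (\<sigma> (2 * i - 1)) (\<sigma> (2 * i))) = single (hafnian_monom n \<sigma>) (1 :: 'k)"
      by (simp add: prod_single hafnian_monom_def)
  qed
  then have "lookup (hafnian n :: 'k mpoly) b = (\<Sum>\<sigma>\<in>hafnian_perms n. of_bool (hafnian_monom n \<sigma> = b))"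
    by (simp add: lookup_sum lookup_single when_def of_bool_def)
  also have "\<dots> = (\<Sum>m\<in>hafnian_monom n ` hafnian_perms n. of_bool (m = b))"
    by (simp add: sum.reindex[OF inj_on_hafnian_monom])
  also have "\<dots> = of_bool (b \<in> hafnian_monom n ` hafnian_perms n)"
    using fin by (simp add: of_bool_def)
  also have "b \<in> hafnian_monom n ` hafnian_perms n \<longleftrightarrow> perfect n 0 b"
    using perfect_hafnian_monom hafnian_monom_surj by blast
  finally show ?thesis .
qed

section \<open>The ideals of the Hafnian and of its homogenized inverse system\<close>

lemma perfect_add:
  "perfect n j (a + m) \<longleftrightarrow> keys a \<subseteq> sym_vars n \<and> keys m \<subseteq> sym_vars n \<and>
     lookup a (1, 1) + lookup m (1, 1) = j \<and> (\<forall>i. vdeg a i + vdeg m i = of_bool (i \<in> {1..2 * n}))"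
  by (auto simp: perfect_def keys_plus_monom lookup_add vdeg_add)

lemma finite_sym_vars: "finite (sym_vars n)"
  by (rule finite_subset[of _ "{1..2 * n} \<times> {1..2 * n}"]) (auto simp: sym_vars_def)

lemma vdeg_outside:
  assumes "keys a \<subseteq> sym_vars n" "i \<notin> {1..2 * n}"
  shows "vdeg a i = 0"
proof (rule ccontr)
  assume "vdeg a i \<noteq> 0"
  then obtain v where "v \<in> keys a" "fst v = i \<or> snd v = i"
    by (rule vdeg_pos_obtain)
  then show False using assms by (fastforce simp: sym_vars_def)
qed

lemma vdeg_eq_0_monom:
  assumes "\<And>i. vdeg a i = 0"
  shows "a = single (1, 1) (lookup a (1, 1))"
proof (rule poly_mapping_eqI)
  fix v
  show "lookup a v = lookup (single (1, 1) (lookup a (1, 1))) v"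
  proof (cases "v = (1, 1)")
    case False
    then have "v \<notin> keys a"
      using vdeg_ge[of v a "fst v"] assms by (auto simp: in_keys_iff)
    then show ?thesis using False by (simp add: in_keys_iff lookup_single when_def)
  qed simp
qed

lemma vdeg_indicator_card:
  assumes "keys a \<subseteq> sym_vars n" "U \<subseteq> {1..2 * n}" "\<And>i. vdeg a i = of_bool (i \<in> U)"
  shows "card U + 2 * lookup a (1, 1) = 2 * monom_degree a"
proof -
  have "(\<Sum>i\<in>{1..2 * n}. vdeg a i) = (\<Sum>i\<in>{1..2 * n}. of_bool (i \<in> U))"
    using assms(3) by (intro sum.cong) auto
  also have "\<dots> = card U"
    using assms(2) by (simp add: Int_absorb1)
  finally show ?thesis
    using vdeg_sum_eq[OF assms(1)] by simp
qed

text \<open>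
  For \<open>K = {0}\<close> this is the apolar ideal of the Hafnian, and for \<open>K = UNIV\<close> it is the intersection of
  the apolar ideals of \<open>x\<^sub>1\<^sub>1\<^sup>j Hf\<close> for all \<open>j\<close>: the ideal of the closed subscheme whose inverse system
  is generated by the dehomogenization of the Hafnian at \<open>x\<^sub>1\<^sub>1 = 1\<close>.
\<close>

definition hafnian_system :: "nat \<Rightarrow> nat set \<Rightarrow> 'k::field mpoly set" where
  "hafnian_system n K =
     inverse_system_ideal (sym_vars n) {\<theta>. \<exists>j\<in>K. \<exists>m. \<theta> = (\<lambda>a. of_bool (perfect n j (a + m)))}"

lemma apolar_ideal_hafnian: "apolar_ideal (sym_vars n) (hafnian n) = hafnian_system n {0}"
proof -
  have "range (\<lambda>m a. lookup (hafnian n :: 'a mpoly) (a + m))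
      = {\<theta>. \<exists>j\<in>{0}. \<exists>m. \<theta> = (\<lambda>a. of_bool (perfect n j (a + m)))}"
    by (auto simp: lookup_hafnian)
  then show ?thesis
    by (simp add: apolar_ideal_eq hafnian_system_def)
qed

lemma hafnian_system_shift:
  assumes "\<theta> \<in> {\<theta>. \<exists>j\<in>K. \<exists>m. \<theta> = (\<lambda>a. of_bool (perfect n j (a + m)))}"
  shows "(\<lambda>b. \<theta> (a + b)) \<in> {\<theta>. \<exists>j\<in>K. \<exists>m. \<theta> = (\<lambda>a. of_bool (perfect n j (a + m)))}"
proof -
  obtain j m where "j \<in> K" "\<theta> = (\<lambda>a. of_bool (perfect n j (a + m)))"
    using assms by blast
  then have "j \<in> K" "(\<lambda>b. \<theta> (a + b)) = (\<lambda>b. of_bool (perfect n j (b + (a + m))))"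
    by (simp_all add: add_ac)
  then show ?thesis by blast
qed

lemma ideal_hafnian_system: "ideal (hafnian_system n K) (poly_ring (sym_vars n))"
  unfolding hafnian_system_def by (rule ideal_inverse_system) (rule hafnian_system_shift)

text \<open>All perfect monomials for one \<open>j\<close> have degree \<open>n + j\<close>, so each
  functional lives in a single degree.\<close>

lemma homogeneous_hafnian_system: "homogeneous_ideal (sym_vars n) (hafnian_system n K)"
  unfolding hafnian_system_def
proof (rule homogeneous_inverse_system, erule hafnian_system_shift)
  fix \<theta> :: "monom \<Rightarrow> 'a" and a b
  assume "\<theta> \<in> {\<theta>. \<exists>j\<in>K. \<exists>m. \<theta> = (\<lambda>a. of_bool (perfect n j (a + m)))}" "\<theta> a \<noteq> 0" "\<theta> b \<noteq> 0"
  then obtain j m where *: "perfect n j (a + m)" "perfect n j (b + m)"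
    by (auto split: if_splits)
  have "2 * monom_degree c = 2 * n + 2 * j" if "perfect n j c" for c
    using vdeg_sum_eq[of c n] that by (simp add: perfect_def)
  from this[OF *(1)] this[OF *(2)] show "monom_degree a = monom_degree b"
    by (simp add: monom_degree_add)
qed

section \<open>Membership by class sums, and Hilbert functions\<close>

lemma in_hafnian_system_iff:
  "f \<in> hafnian_system n K \<longleftrightarrow> f \<in> carrier (poly_ring (sym_vars n))
     \<and> (\<forall>j\<in>K. \<forall>m. pairing f (\<lambda>a. of_bool (perfect n j (a + m))) = 0)"
  by (auto simp: hafnian_system_def inverse_system_ideal_def)

lemma single_in_hafnian_system:
  assumes "keys a \<subseteq> sym_vars n" "\<And>j m. j \<in> K \<Longrightarrow> \<not> perfect n j (a + m)"
  shows "single a c \<in> hafnian_system n K"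
  using assms by (simp add: in_hafnian_system_iff single_in_carrier)

lemma single_in_hafnian_system_vdeg:
  assumes "keys a \<subseteq> sym_vars n" "vdeg a i \<ge> 2"
  shows "single a c \<in> hafnian_system n K"
proof (rule single_in_hafnian_system[OF assms(1)])
  show "\<not> perfect n j (a + m)" for j m
  proof
    assume "perfect n j (a + m)"
    then have "vdeg a i + vdeg m i = of_bool (i \<in> {1..2 * n})"
      by (simp add: perfect_add)
    then show False using assms(2) by (simp add: of_bool_def split: if_splits)
  qed
qed

text \<open>A functional that does not vanish on all monomials of \<open>f\<close> is there the
  indicator of one class: the vertices missed by \<open>m\<close>, with the loop exponent that
  \<open>m\<close> leaves over. Conversely every even vertex set is tested by a matching of its
  complement. \<open>K\<close> is downward closed because \<open>m\<close> may use up any part of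
  the exponent \<open>j\<close>.\<close>

lemma in_hafnian_system_iff_class_sums:
  fixes f :: "'k::field mpoly"
  assumes K: "\<forall>j\<in>K. \<forall>k\<le>j. k \<in> K"
  shows "f \<in> hafnian_system n K \<longleftrightarrow> f \<in> carrier (poly_ring (sym_vars n))
    \<and> (\<forall>U k. U \<subseteq> {1..2 * n} \<longrightarrow> even (card U) \<longrightarrow> k \<in> K \<longrightarrow>
        (\<Sum>a\<in>{a\<in>keys f. lookup a (1, 1) = k \<and> (\<forall>i. vdeg a i = of_bool (i \<in> U))}. lookup f a) = 0)"
    (is "_ \<longleftrightarrow> _ \<and> ?classes")
proof -
  have "(\<forall>j\<in>K. \<forall>m. pairing f (\<lambda>a. of_bool (perfect n j (a + m))) = 0) \<longleftrightarrow> ?classes"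
    if f: "f \<in> carrier (poly_ring (sym_vars n))"
  proof (intro iffI allI impI ballI)
    fix U k assume p: "\<forall>j\<in>K. \<forall>m. pairing f (\<lambda>a. of_bool (perfect n j (a + m))) = 0"
      and U: "U \<subseteq> {1..2 * n}" "even (card U)" and k: "k \<in> K"
    let ?U = "{1..2 * n} - U"
    have "card ?U = 2 * n - card U"
      using U(1) by (simp add: card_Diff_subset finite_subset)
    then have "card ?U = 2 * (card ?U div 2)"
      using U(2) by auto
    \<comment> \<open>This matching contains no loop, so it completes exactly the class of
      \<open>U\<close> and \<open>k\<close>.\<close>
    then obtain m where m: "keys m \<subseteq> {(i, j). i \<in> ?U \<and> j \<in> ?U \<and> i < j}" "\<And>i. vdeg m i = of_bool (i \<in> ?U)"
      using matching_exists[of ?U] by blast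
    have mV: "keys m \<subseteq> sym_vars n"
      using m(1) by (fastforce simp: sym_vars_def)
    have m0: "lookup m (1, 1) = 0"
      using m(1) by (auto simp: in_keys_iff[symmetric] not_in_keys_iff_lookup_eq_zero[symmetric])
    have vd: "vdeg a i + vdeg m i = of_bool (i \<in> {1..2 * n}) \<longleftrightarrow> vdeg a i = of_bool (i \<in> U)" for a i
      using U(1) by (auto simp: m(2))
    have "perfect n k (a + m) \<longleftrightarrow> lookup a (1, 1) = k \<and> (\<forall>i. vdeg a i = of_bool (i \<in> U))"
      if "a \<in> keys f" for a
    proof -
      have "keys a \<subseteq> sym_vars n" using f that by (simp add: in_carrier_iff)
      then show ?thesis using mV unfolding perfect_add m0 vd by simp
    qed
    then have "pairing f (\<lambda>a. of_bool (perfect n k (a + m)))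
      = (\<Sum>a\<in>keys f. if lookup a (1, 1) = k \<and> (\<forall>i. vdeg a i = of_bool (i \<in> U)) then lookup f a else 0)"
      unfolding pairing_def by (intro sum.cong) auto
    also have "\<dots> = (\<Sum>a\<in>{a\<in>keys f. lookup a (1, 1) = k \<and> (\<forall>i. vdeg a i = of_bool (i \<in> U))}. lookup f a)"
      by (rule sum.inter_filter[symmetric]) simp
    finally show "(\<Sum>a\<in>{a\<in>keys f. lookup a (1, 1) = k \<and> (\<forall>i. vdeg a i = of_bool (i \<in> U))}. lookup f a) = 0"
      using p k by simp
  next
    fix j m assume c: ?classes and j: "j \<in> K"
    show "pairing f (\<lambda>a. of_bool (perfect n j (a + m))) = 0"
    \<comment> \<open>One completed monomial supplies the bounds on \<open>m\<close> needed to
      define the class: vertex degrees at most 1 and a loop exponent at most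
      \<open>j\<close>.\<close>
    proof (cases "\<exists>a\<in>keys f. perfect n j (a + m)")
      case False
      then show ?thesis by (auto simp: pairing_def intro!: sum.neutral)
    next
      case True
      then obtain a0 where a0: "a0 \<in> keys f" "perfect n j (a0 + m)" by blast
      define U where "U = {i \<in> {1..2 * n}. vdeg m i = 0}"
      define k where "k = j - lookup m (1, 1)"
      have jk: "j = k + lookup m (1, 1)" and mV: "keys m \<subseteq> sym_vars n"
        and vsum: "\<And>i. vdeg a0 i + vdeg m i = of_bool (i \<in> {1..2 * n})"
        using a0(2) by (auto simp: perfect_add k_def)
      have m01: "vdeg m i \<le> of_bool (i \<in> {1..2 * n})" for i
        using vsum[of i] by linarith
      have vd: "vdeg a i + vdeg m i = of_bool (i \<in> {1..2 * n}) \<longleftrightarrow> vdeg a i = of_bool (i \<in> U)" for a i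
        using m01[of i] by (auto simp: U_def)
      have iff: "perfect n j (a + m) \<longleftrightarrow> lookup a (1, 1) = k \<and> (\<forall>i. vdeg a i = of_bool (i \<in> U))"
        if "a \<in> keys f" for a
      proof -
        have "keys a \<subseteq> sym_vars n" using f that by (simp add: in_carrier_iff)
        then show ?thesis using mV unfolding perfect_add jk vd by simp
      qed
      have "keys a0 \<subseteq> sym_vars n" using f a0 by (simp add: in_carrier_iff)
      then have "card U + 2 * lookup a0 (1, 1) = 2 * monom_degree a0"
        using iff[OF a0(1)] a0(2) by (intro vdeg_indicator_card[of _ n]) (auto simp: U_def)
      then have U: "U \<subseteq> {1..2 * n}" "even (card U)"
        by (auto simp: U_def) presburger
      have "pairing f (\<lambda>a. of_bool (perfect n j (a + m)))
        = (\<Sum>a\<in>keys f. if lookup a (1, 1) = k \<and> (\<forall>i. vdeg a i = of_bool (i \<in> U)) then lookup f a else 0)"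
        unfolding pairing_def by (intro sum.cong) (auto simp: iff)
      also have "\<dots> = (\<Sum>a\<in>{a\<in>keys f. lookup a (1, 1) = k \<and> (\<forall>i. vdeg a i = of_bool (i \<in> U))}. lookup f a)"
        by (rule sum.inter_filter[symmetric]) simp
      also have "\<dots> = 0"
        using c U K j by (simp add: jk)
      finally show ?thesis .
    qed
  qed
  then show ?thesis
    unfolding in_hafnian_system_iff by (rule conj_cong[OF refl])
qed

text \<open>Sums over disjoint nonempty classes are independent functionals, with representatives of
  the classes as a dual family; so their common kernel has codimension
  \<open>card Q\<close>.\<close>

lemma class_dim:
  fixes P :: "'q \<Rightarrow> monom set" and V and Q t
  defines "W \<equiv> {f \<in> graded_part t (carrier (poly_ring V)). \<forall>q\<in>Q. (\<Sum>a\<in>P q. lookup f a) = (0::'k::field)}"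
  assumes V: "finite V" and Q: "finite Q"
    and P: "\<And>q. q \<in> Q \<Longrightarrow> P q \<subseteq> monomials V t" "\<And>q. q \<in> Q \<Longrightarrow> P q \<noteq> {}"
    and disj: "\<And>q q'. q \<in> Q \<Longrightarrow> q' \<in> Q \<Longrightarrow> q \<noteq> q' \<Longrightarrow> P q \<inter> P q' = {}"
  shows "mpoly.dim (graded_part t (carrier (poly_ring V) :: 'k mpoly set)) = mpoly.dim W + card Q"
proof -
  let ?S = "graded_part t (carrier (poly_ring V)) :: 'k mpoly set"
  define r where "r q = (SOME a. a \<in> P q)" for q
  have r: "r q \<in> P q" if "q \<in> Q" for q
    unfolding r_def using P(2)[OF that] by (simp add: some_in_eq)
  have rP: "r q' \<in> P q \<longleftrightarrow> q' = q" if "q \<in> Q" "q' \<in> Q" for q q'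
    using r[OF that(2)] disj[OF that] that by auto
  define y where "y q = single (r q) (1 :: 'k)" for q
  have y: "y q \<in> ?S" if "q \<in> Q" for q
    using r[OF that] P(1)[OF that] by (auto simp: y_def keys_graded_part)
  have inj: "inj_on y Q"
  proof (rule inj_onI)
    fix q q' assume q: "q \<in> Q" "q' \<in> Q" and "y q = y q'"
    then have "keys (y q) = keys (y q')" by simp
    then have "r q = r q'" by (simp add: y_def)
    then show "q = q'" using rP[OF q] r[OF q(1)] by (metis q rP)
  qed
  have class_sum: "(\<Sum>a\<in>P q. lookup (\<Sum>q\<in>Q. scalar_mult (d q) (y q)) a) = d q" if q: "q \<in> Q" for q d
  proof -
    have fin: "finite (P q)" using P(1)[OF q] finite_monomials[OF V] by (rule finite_subset)
    have "(\<Sum>a\<in>P q. lookup (\<Sum>q\<in>Q. scalar_mult (d q) (y q)) a)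
      = (\<Sum>q'\<in>Q. \<Sum>a\<in>P q. if r q' = a then d q' else 0)"
      by (subst sum.swap) (simp add: lookup_sum y_def lookup_single when_def if_distrib[of "\<lambda>x. _ * x"] cong: if_cong)
    also have "\<dots> = (\<Sum>q'\<in>Q. if q' = q then d q' else 0)"
      using rP[OF q] fin by (intro sum.cong) auto
    also have "\<dots> = d q" using Q q by simp
    finally show ?thesis .
  qed
  have "mpoly.dim ?S = mpoly.dim W + card (y ` Q)"
  proof (rule mpoly.dim_add_card_eq[OF finite_imageI[OF finite_monomials[OF V]] graded_part_span])
    have S: "mpoly.subspace ?S" by (rule subspace_graded_part[OF ideal_carrier])
    show "mpoly.subspace W"
      unfolding W_def
      by (rule mpoly.subspaceI)
        (auto simp: mpoly.subspace_0[OF S] mpoly.subspace_add[OF S] mpoly.subspace_scale[OF S]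
          lookup_add sum.distrib simp flip: sum_distrib_left)
    show "W \<subseteq> ?S" by (auto simp: W_def)
    show "finite (y ` Q)" using Q by simp
    show "y ` Q \<subseteq> ?S" using y by auto
    show "?S \<subseteq> mpoly.span (W \<union> y ` Q)"
    proof
      fix f assume f: "f \<in> ?S"
      let ?g = "\<Sum>q\<in>Q. scalar_mult (\<Sum>a\<in>P q. lookup f a) (y q)"
      have "?g \<in> ?S"
        using y by (intro mpoly.subspace_sum[OF S] mpoly.subspace_scale[OF S])
      then have "f - ?g \<in> ?S"
        using f mpoly.subspace_diff[OF S] by blast
      moreover have "(\<Sum>a\<in>P q. lookup (f - ?g) a) = 0" if "q \<in> Q" for q
        using class_sum[OF that] by (simp add: lookup_minus sum_subtractf)
      ultimately have "f - ?g \<in> W" by (simp add: W_def)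
      then have "f - ?g \<in> mpoly.span (W \<union> y ` Q)"
        by (intro mpoly.span_base) simp
      moreover have "?g \<in> mpoly.span (W \<union> y ` Q)"
        by (intro mpoly.span_sum mpoly.span_scale mpoly.span_base) simp
      ultimately have "(f - ?g) + ?g \<in> mpoly.span (W \<union> y ` Q)"
        by (rule mpoly.span_add)
      then show "f \<in> mpoly.span (W \<union> y ` Q)" by simp
    qed
    fix c x assume "(\<Sum>x\<in>y ` Q. scalar_mult (c x) x) \<in> W" and x: "x \<in> y ` Q"
    then have "(\<Sum>q\<in>Q. scalar_mult (c (y q)) (y q)) \<in> W"
      by (simp add: sum.reindex[OF inj])
    then have "c (y q) = 0" if "q \<in> Q" for q
      using class_sum[OF that, of "\<lambda>q. c (y q)"] that by (simp add: W_def)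
    then show "c x = 0" using x by auto
  qed
  then show ?thesis by (simp add: card_image[OF inj])
qed

text \<open>In degree \<open>t\<close> the vertex set determines the loop exponent as
  \<open>t - card U div 2\<close>, so the classes are indexed by \<open>U\<close> alone, and
  \<open>K\<close> decides which of them impose a condition.\<close>

lemma hilbert_function_hafnian_system:
  assumes n: "n \<ge> 1" and K: "\<forall>j\<in>K. \<forall>k\<le>j. k \<in> K"
  shows "hilbert_function (sym_vars n) (hafnian_system n K :: 'k::field mpoly set) t
    = card {U. U \<subseteq> {1..2 * n} \<and> even (card U) \<and> card U \<le> 2 * t \<and> t - card U div 2 \<in> K}"
    (is "_ = card ?Q")
proof -
  let ?V = "sym_vars n"
  define P where "P U = {a \<in> monomials ?V t. \<forall>i. vdeg a i = of_bool (i \<in> U)}" for U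
  have P_card: "card U + 2 * lookup a (1, 1) = 2 * t" if "a \<in> P U" "U \<subseteq> {1..2 * n}" for a U
    using that vdeg_indicator_card[of a n U] by (auto simp: P_def monomials_def)
  have eq: "graded_part t (hafnian_system n K :: 'k mpoly set)
    = {f \<in> graded_part t (carrier (poly_ring ?V)). \<forall>U\<in>?Q. (\<Sum>a\<in>P U. lookup f a) = 0}"
  proof (intro equalityI subsetI)
    fix f :: "'k mpoly" assume "f \<in> graded_part t (hafnian_system n K)"
    then have f: "f \<in> hafnian_system n K" "homogeneous t f" "f \<in> graded_part t (carrier (poly_ring ?V))"
      by (auto simp: graded_part_def in_hafnian_system_iff)
    have "(\<Sum>a\<in>P U. lookup f a) = 0" if U: "U \<in> ?Q" for U
    proof -
      have fin: "finite (P U)" using finite_monomials[OF finite_sym_vars] by (simp add: P_def)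
      have "{a\<in>keys f. lookup a (1, 1) = t - card U div 2 \<and> (\<forall>i. vdeg a i = of_bool (i \<in> U))} = keys f \<inter> P U"
        using f(3) P_card[of _ U] U by (fastforce simp: keys_graded_part P_def)
      moreover have "(\<Sum>a\<in>{a\<in>keys f. lookup a (1, 1) = t - card U div 2 \<and> (\<forall>i. vdeg a i = of_bool (i \<in> U))}. lookup f a) = 0"
        using f(1) U by (subst (asm) in_hafnian_system_iff_class_sums[OF K]) blast+
      ultimately have "(\<Sum>a\<in>keys f \<inter> P U. lookup f a) = 0"
        by (simp only:)
      moreover have "(\<Sum>a\<in>keys f \<inter> P U. lookup f a) = (\<Sum>a\<in>P U. lookup f a)"
        using fin by (intro sum.mono_neutral_left) (auto simp: in_keys_iff)
      ultimately show ?thesis by simp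
    qed
    then show "f \<in> {f \<in> graded_part t (carrier (poly_ring ?V)). \<forall>U\<in>?Q. (\<Sum>a\<in>P U. lookup f a) = 0}"
      using f by simp
  next
    fix f :: "'k mpoly"
    assume f: "f \<in> {f \<in> graded_part t (carrier (poly_ring ?V)). \<forall>U\<in>?Q. (\<Sum>a\<in>P U. lookup f a) = 0}"
    then have fm: "keys f \<subseteq> monomials ?V t" and fS: "f \<in> carrier (poly_ring ?V)" and ht: "homogeneous t f"
      by (auto simp: keys_graded_part[symmetric] graded_part_def)
    have class0: "(\<Sum>a\<in>{a\<in>keys f. lookup a (1, 1) = k \<and> (\<forall>i. vdeg a i = of_bool (i \<in> U))}. lookup f a) = 0"
      if U: "U \<subseteq> {1..2 * n}" "even (card U)" and k: "k \<in> K" for U k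
    proof (cases "card U + 2 * k = 2 * t")
      case True
      then have "t - card U div 2 = k" by presburger
      then have UQ: "U \<in> ?Q" using U k True by simp
      have fin: "finite (P U)" using finite_monomials[OF finite_sym_vars] by (simp add: P_def)
      have "{a\<in>keys f. lookup a (1, 1) = k \<and> (\<forall>i. vdeg a i = of_bool (i \<in> U))} = keys f \<inter> P U"
        using fm P_card[of _ U] U True by (fastforce simp: P_def)
      moreover have "(\<Sum>a\<in>keys f \<inter> P U. lookup f a) = (\<Sum>a\<in>P U. lookup f a)"
        using fin by (intro sum.mono_neutral_left) (auto simp: in_keys_iff)
      ultimately show ?thesis using f UQ by simp
    next
      case False
      have none: "\<not> (lookup a (1, 1) = k \<and> (\<forall>i. vdeg a i = of_bool (i \<in> U)))" if "a \<in> keys f" for a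
      proof
        assume a: "lookup a (1, 1) = k \<and> (\<forall>i. vdeg a i = of_bool (i \<in> U))"
        then have "a \<in> P U" using fm that unfolding P_def by blast
        from P_card[OF this U(1)] a False show False by simp
      qed
      show ?thesis
      proof (rule sum.neutral, rule ballI)
        fix a assume "a \<in> {a\<in>keys f. lookup a (1, 1) = k \<and> (\<forall>i. vdeg a i = of_bool (i \<in> U))}"
        then show "lookup f a = 0"
          unfolding mem_Collect_eq using none[of a] by argo
      qed
    qed
    have "f \<in> hafnian_system n K"
      unfolding in_hafnian_system_iff_class_sums[OF K] by (intro conjI allI impI fS class0)
    then show "f \<in> graded_part t (hafnian_system n K)"
      using ht by (simp add: graded_part_def)
  qed
  have "mpoly.dim (graded_part t (carrier (poly_ring ?V) :: 'k mpoly set))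
    = mpoly.dim (graded_part t (hafnian_system n K :: 'k mpoly set)) + card ?Q"
    unfolding eq
  proof (rule class_dim[OF finite_sym_vars])
    show "finite ?Q" by (rule finite_subset[of _ "Pow {1..2 * n}"]) auto
    show "P U \<subseteq> monomials ?V t" for U by (auto simp: P_def)
    show "P U \<noteq> {}" if U: "U \<in> ?Q" for U
    proof -
      have "finite U" using U by (auto intro: finite_subset)
      moreover have "card U = 2 * (card U div 2)" using U by auto
      ultimately obtain m where m: "keys m \<subseteq> {(i, j). i \<in> U \<and> j \<in> U \<and> i < j}"
        "\<And>i. vdeg m i = of_bool (i \<in> U)" "monom_degree m = card U div 2"
        using matching_exists[of U] by blast
      have "keys (single (1, 1) (t - card U div 2)) \<subseteq> ?V"
        using n by (auto simp: sym_vars_def split: if_splits)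
      moreover have "keys m \<subseteq> ?V"
        using m(1) U by (fastforce simp: sym_vars_def)
      moreover have "card U div 2 \<le> t"
        using U by auto
      \<comment> \<open>A matching of \<open>U\<close>, filled up to degree \<open>t\<close> with
        the loop.\<close>
      ultimately have "m + single (1, 1) (t - card U div 2) \<in> P U"
        by (simp add: P_def monomials_def keys_plus_monom monom_degree_add m(2,3) vdeg_add vdeg_single)
      then show ?thesis by blast
    qed
    show "P U \<inter> P U' = {}" if "U \<noteq> U'" for U U'
    proof (rule ccontr)
      assume "P U \<inter> P U' \<noteq> {}"
      then obtain a where "\<And>i. vdeg a i = of_bool (i \<in> U)" "\<And>i. vdeg a i = of_bool (i \<in> U')"
        unfolding P_def by blast
      then have "i \<in> U \<longleftrightarrow> i \<in> U'" for i by (metis of_bool_eq_iff)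
      then show False using that by blast
    qed
  qed
  then show ?thesis by (simp add: hilbert_function_eq)
qed

text \<open>Parity decides whether \<open>x\<close> belongs to an even subset, so deleting
  \<open>x\<close> is a bijection onto the subsets of the rest.\<close>

lemma card_even_subsets:
  assumes "finite A" "x \<in> A"
  shows "card {U. U \<subseteq> A \<and> even (card U)} = 2 ^ (card A - 1)"
proof -
  have "bij_betw (\<lambda>U. U - {x}) {U. U \<subseteq> A \<and> even (card U)} (Pow (A - {x}))"
  proof (rule bij_betw_byWitness[where f' = "\<lambda>U. if even (card U) then U else insert x U"])
    have fin: "finite U" if "U \<subseteq> A" for U using assms(1) that by (rule rev_finite_subset)
    have card_rm: "card U = Suc (card (U - {x}))" if "U \<subseteq> A" "x \<in> U" for U
      using card.remove[OF fin[OF that(1)] that(2)] .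
    show "\<forall>U\<in>{U. U \<subseteq> A \<and> even (card U)}. (if even (card (U - {x})) then U - {x} else insert x (U - {x})) = U"
    proof
      fix U assume U: "U \<in> {U. U \<subseteq> A \<and> even (card U)}"
      show "(if even (card (U - {x})) then U - {x} else insert x (U - {x})) = U"
        using U card_rm[of U] by (cases "x \<in> U") auto
    qed
    show "\<forall>U\<in>Pow (A - {x}). (if even (card U) then U else insert x U) - {x} = U" by auto
    show "(\<lambda>U. U - {x}) ` {U. U \<subseteq> A \<and> even (card U)} \<subseteq> Pow (A - {x})" by auto
    show "(\<lambda>U. if even (card U) then U else insert x U) ` Pow (A - {x}) \<subseteq> {U. U \<subseteq> A \<and> even (card U)}"
    proof (intro image_subsetI)
      fix U assume U: "U \<in> Pow (A - {x})"
      then have "card (insert x U) = Suc (card U)"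
        using fin[of U] by (intro card_insert_disjoint) auto
      then show "(if even (card U) then U else insert x U) \<in> {U. U \<subseteq> A \<and> even (card U)}"
        using U assms(2) by auto
    qed
  qed
  then have "card {U. U \<subseteq> A \<and> even (card U)} = card (Pow (A - {x}))"
    by (rule bij_betw_same_card)
  then show ?thesis using assms by (simp add: card_Pow)
qed

text \<open>With \<open>K = {0}\<close> no loop may fill up the degree, so degree \<open>t\<close>
  carries the subsets of size \<open>2 * t\<close>, and over all degrees each even subset is counted
  once.\<close>

lemma length_apolar_hafnian:
  assumes n: "n \<ge> 1"
  shows "(\<Sum>t\<le>n. hilbert_function (sym_vars n) (hafnian_system n {0} :: 'k::field mpoly set) t) = 2 ^ (2 * n - 1)"
proof -
  have "(\<Sum>t\<le>n. hilbert_function (sym_vars n) (hafnian_system n {0} :: 'k mpoly set) t)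
    = (\<Sum>t\<le>n. card {U. U \<subseteq> {1..2 * n} \<and> card U = 2 * t})"
  proof (rule sum.cong[OF refl])
    fix t
    have *: "even c \<and> c \<le> 2 * t \<and> t - c div 2 \<in> {0} \<longleftrightarrow> c = 2 * t" for c :: nat
      by auto
    have "hilbert_function (sym_vars n) (hafnian_system n {0} :: 'k mpoly set) t
      = card {U. U \<subseteq> {1..2 * n} \<and> even (card U) \<and> card U \<le> 2 * t \<and> t - card U div 2 \<in> {0}}"
      by (rule hilbert_function_hafnian_system[OF n]) simp
    then show "hilbert_function (sym_vars n) (hafnian_system n {0} :: 'k mpoly set) t
      = card {U. U \<subseteq> {1..2 * n} \<and> card U = 2 * t}"
      unfolding * .
  qed
  also have "\<dots> = card (\<Union>t\<in>{..n}. {U. U \<subseteq> {1..2 * n} \<and> card U = 2 * t})"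
  proof (rule card_UN_disjoint[symmetric])
    show "\<forall>t\<in>{..n}. finite {U. U \<subseteq> {1..2 * n} \<and> card U = 2 * t}"
      by (auto intro: finite_subset[of _ "Pow {1..2 * n}"])
  qed auto
  also have "(\<Union>t\<in>{..n}. {U. U \<subseteq> {1..2 * n} \<and> card U = 2 * t}) = {U. U \<subseteq> {1..2 * n} \<and> even (card U)}"
  proof (intro equalityI subsetI)
    fix U assume U: "U \<in> {U. U \<subseteq> {1..2 * n} \<and> even (card U)}"
    then have "card U \<le> card {1..2 * n}" by (intro card_mono) auto
    then show "U \<in> (\<Union>t\<in>{..n}. {U. U \<subseteq> {1..2 * n} \<and> card U = 2 * t})"
      using U by (auto elim!: evenE)
  qed auto
  also have "card \<dots> = 2 ^ (2 * n - 1)"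
    using card_even_subsets[of "{1..2 * n}" 1] n by simp
  finally show ?thesis .
qed

text \<open>From degree \<open>n\<close> on the loop can fill up every even subset, so the Hilbert
  function is constant.\<close>

lemma has_degree_hafnian_system:
  assumes n: "n \<ge> 1"
  shows "has_degree (sym_vars n) (hafnian_system n UNIV :: 'k::field mpoly set) (2 ^ (2 * n - 1))"
  unfolding has_degree_def eventually_sequentially
proof (intro exI allI impI)
  fix t assume "n \<le> t"
  have "{U. U \<subseteq> {1..2 * n} \<and> even (card U) \<and> card U \<le> 2 * t \<and> t - card U div 2 \<in> UNIV}
    = {U. U \<subseteq> {1..2 * n} \<and> even (card U)}"
  proof -
    have "card U \<le> 2 * t" if "U \<subseteq> {1..2 * n}" for U
      using card_mono[OF _ that] \<open>n \<le> t\<close> by simp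
    then show ?thesis by auto
  qed
  then show "hilbert_function (sym_vars n) (hafnian_system n UNIV :: 'k mpoly set) t = 2 ^ (2 * n - 1)"
    using hilbert_function_hafnian_system[OF n, of UNIV t] card_even_subsets[of "{1..2 * n}" 1] n
    by simp
qed

text \<open>The square of any variable but the loop at 1 has a vertex of degree at least 2; the
  square of that loop is ruled out when 0 is the only exponent.\<close>

lemma sq_in_hafnian_system:
  assumes "v \<in> sym_vars n" "v \<noteq> (1, 1) \<or> K \<subseteq> {0}"
  shows "var v * var v \<in> hafnian_system n K"
proof -
  let ?a = "single v 1 + single v 1 :: monom"
  have keys: "keys ?a \<subseteq> sym_vars n" using assms(1) by (simp add: keys_plus_monom)
  have "single ?a 1 \<in> hafnian_system n K"
  proof (cases "v = (1, 1)")
    case False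
    then show ?thesis
      using keys by (intro single_in_hafnian_system_vdeg[of _ _ "fst v"]) (auto simp: vdeg_add vdeg_single)
  next
    case True
    then show ?thesis
      using assms(2) keys by (intro single_in_hafnian_system) (auto simp: perfect_add lookup_add)
  qed
  then show ?thesis by (simp add: var_def mult_single)
qed

section \<open>The upper bound for the cactus rank\<close>

lemma monom_add_eq_single:
  fixes a b :: monom
  assumes "a + b = single v k"
  obtains i j where "a = single v i" "b = single v j" "i + j = k"
proof
  have sum: "lookup a w + lookup b w = lookup (single v k) w" for w
    using assms by (metis lookup_add)
  have *: "lookup a w = lookup (single v (lookup a v)) w" "lookup b w = lookup (single v (lookup b v)) w" for w
    using sum[of w] by (cases "w = v"; simp add: lookup_single when_def)+
  show "a = single v (lookup a v)" "b = single v (lookup b v)"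
    by (rule poly_mapping_eqI, rule *)+
  show "lookup a v + lookup b v = k" using sum[of v] by simp
qed

lemma single_inject: "single v i = single v j \<longleftrightarrow> i = (j :: nat)"
  by (metis lookup_single_eq)

text \<open>Geometrically, the prime of the coordinate point at \<open>v\<close>, generated by the
  other variables of \<open>V\<close>. The case \<open>k = 0\<close> excludes constant
  terms.\<close>

definition point_ideal :: "(nat \<times> nat) set \<Rightarrow> nat \<times> nat \<Rightarrow> 'k::field mpoly set" where
  "point_ideal V v = {f \<in> carrier (poly_ring V). \<forall>k. lookup f (single v k) = 0}"

text \<open>Factors of a pure power are pure powers, so shifting the functionals adds no condition;
  in this form the general lemmas on ideals and grading apply.\<close>

lemma point_ideal_eq:
  "point_ideal V v = inverse_system_ideal V {\<theta>. \<exists>m k. \<theta> = (\<lambda>a. of_bool (a + m = single v k))}"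
proof -
  have "pairing f (\<lambda>a. of_bool (a + m = single v k)) = 0"
    if "\<forall>k. lookup f (single v k) = 0" for f :: "'a mpoly" and m k
    unfolding pairing_def using that
    by (intro sum.neutral) (auto elim!: monom_add_eq_single)
  moreover have "lookup f (single v k) = pairing f (\<lambda>a. of_bool (a + 0 = single v k))"
    for f :: "'a mpoly" and k
    by (simp add: pairing_def of_bool_def in_keys_iff if_distrib[of "\<lambda>x. _ * x"] cong: if_cong)
  ultimately have "(\<forall>k. lookup f (single v k) = 0)
      \<longleftrightarrow> (\<forall>m k. pairing f (\<lambda>a. of_bool (a + m = single v k)) = 0)" for f :: "'a mpoly"
    by metis
  then have "(\<forall>k. lookup f (single v k) = 0)
      \<longleftrightarrow> (\<forall>\<theta>\<in>{\<theta>. \<exists>m k. \<theta> = (\<lambda>a. of_bool (a + m = single v k))}. pairing f \<theta> = 0)" for f :: "'a mpoly"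
    by auto
  then show ?thesis
    by (simp only: point_ideal_def inverse_system_ideal_def)
qed

lemma homogeneous_point_ideal: "homogeneous_ideal V (point_ideal V v)"
  unfolding point_ideal_eq
proof (rule homogeneous_inverse_system)
  fix \<theta> :: "monom \<Rightarrow> 'a" and a
  assume "\<theta> \<in> {\<theta>. \<exists>m k. \<theta> = (\<lambda>a. of_bool (a + m = single v k))}"
  then obtain m k where "\<theta> = (\<lambda>a. of_bool (a + m = single v k))" by blast
  then have "(\<lambda>b. \<theta> (a + b)) = (\<lambda>b. of_bool (b + (a + m) = single v k))"
    by (simp add: add_ac)
  then show "(\<lambda>b. \<theta> (a + b)) \<in> {\<theta>. \<exists>m k. \<theta> = (\<lambda>a. of_bool (a + m = single v k))}"
    by blast
next
  fix \<theta> :: "monom \<Rightarrow> 'a" and a b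
  assume "\<theta> \<in> {\<theta>. \<exists>m k. \<theta> = (\<lambda>a. of_bool (a + m = single v k))}" "\<theta> a \<noteq> 0" "\<theta> b \<noteq> 0"
  then obtain m k where "a + m = single v k" "b + m = single v k"
    by (auto split: if_splits)
  then have "monom_degree (a + m) = monom_degree (b + m)" by simp
  then show "monom_degree a = monom_degree b" by (simp add: monom_degree_add)
qed

lemma ideal_point_ideal: "ideal (point_ideal V v) (poly_ring V)"
  by (rule homogeneous_point_ideal[unfolded homogeneous_ideal_def, THEN conjunct1])

text \<open>The lowest pure powers of \<open>v\<close> in two elements outside the ideal multiply to
  a pure power that nothing cancels, as in one variable.\<close>

lemma primeideal_point_ideal: "primeideal (point_ideal V v :: 'k::field mpoly set) (poly_ring V)"
proof (rule primeidealI[OF ideal_point_ideal cring_poly_ring])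
  have "1 \<in> carrier (poly_ring V)" by (simp add: in_carrier_iff)
  moreover have "(1 :: 'k mpoly) \<notin> point_ideal V v"
    by (auto simp: point_ideal_def lookup_one intro!: exI[of _ 0])
  ultimately show "carrier (poly_ring V) \<noteq> (point_ideal V v :: 'k mpoly set)" by blast
next
  fix f g :: "'k mpoly"
  assume S: "f \<in> carrier (poly_ring V)" "g \<in> carrier (poly_ring V)"
    and fg: "f \<otimes>\<^bsub>poly_ring V\<^esub> g \<in> point_ideal V v"
  show "f \<in> point_ideal V v \<or> g \<in> point_ideal V v"
  proof (rule ccontr)
    assume "\<not> (f \<in> point_ideal V v \<or> g \<in> point_ideal V v)"
    then have ex: "\<exists>i. lookup f (single v i) \<noteq> 0" "\<exists>j. lookup g (single v j) \<noteq> 0"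
      using S by (auto simp: point_ideal_def)
    define i where "i = (LEAST i. lookup f (single v i) \<noteq> 0)"
    define j where "j = (LEAST j. lookup g (single v j) \<noteq> 0)"
    have nz: "lookup f (single v i) \<noteq> 0" "lookup g (single v j) \<noteq> 0"
      unfolding i_def j_def by (rule LeastI_ex[OF ex(1)], rule LeastI_ex[OF ex(2)])
    have least: "i \<le> i'" "j \<le> j'" if "lookup f (single v i') \<noteq> 0" "lookup g (single v j') \<noteq> 0" for i' j'
      unfolding i_def j_def using that by (auto intro: Least_le)
    have only: "a = single v i \<and> b = single v j"
      if ab: "a \<in> keys f" "b \<in> keys g" "a + b = single v (i + j)" for a b
    proof -
      obtain i' j' where *: "a = single v i'" "b = single v j'" "i' + j' = i + j"
        using ab(3) by (rule monom_add_eq_single)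
      then have "i \<le> i'" "j \<le> j'" using least[of i' j'] ab(1,2) by (auto simp: in_keys_iff)
      then have "i' = i" "j' = j" using *(3) by linarith+
      then show ?thesis using * by simp
    qed
    have "lookup (f * g) (single v (i + j))
      = (\<Sum>a\<in>keys f. \<Sum>b\<in>keys g. if a + b = single v (i + j) then lookup f a * lookup g b else 0)"
      by (simp add: mpoly_mult_expand[of f g] lookup_sum lookup_single when_def)
    also have "\<dots> = (\<Sum>a\<in>keys f. \<Sum>b\<in>keys g.
        if b = single v j then if a = single v i then lookup f a * lookup g b else 0 else 0)"
    proof (intro sum.cong refl)
      fix a b assume "a \<in> keys f" "b \<in> keys g"
      then show "(if a + b = single v (i + j) then lookup f a * lookup g b else 0)
          = (if b = single v j then if a = single v i then lookup f a * lookup g b else 0 else 0)"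
        using only[of a b] by (auto simp: single_add)
    qed
    also have "\<dots> = lookup f (single v i) * lookup g (single v j)"
      using nz by (simp add: in_keys_iff)
    finally have "lookup (f * g) (single v (i + j)) \<noteq> 0"
      using nz by simp
    then show False using fg by (simp add: point_ideal_def)
  qed
qed

lemma prime_contains_power:
  assumes P: "primeideal P (poly_ring V)" and v: "v \<in> V" and "single (single v k) 1 \<in> P"
  shows "var v \<in> P"
  using assms(3)
proof (induction k)
  case 0
  interpret primeideal P "poly_ring V" by (rule P)
  have "1 \<in> P" using 0 by simp
  then have "P = carrier (poly_ring V)" using one_imp_carrier by simp
  then show ?case using I_notcarr by simp
next
  case (Suc k)
  interpret primeideal P "poly_ring V" by (rule P)
  have "var v * single (single v k) 1 \<in> P"
    using Suc.prems by (simp add: var_def mult_single flip: single_add)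
  then have "var v \<in> P \<or> single (single v k) 1 \<in> P"
    using I_prime[OF var_in_carrier[OF v] single_in_carrier[of "single v k" V 1]] v by simp
  then show ?case using Suc.IH by blast
qed

text \<open>A prime in the support contains every other variable, hence the point ideal. Were it
  larger, a homogeneous element would yield a pure power of \<open>v\<close>, thus \<open>v\<close>
  itself, and no variable would be left outside.\<close>

lemma support_eq_point_ideal:
  fixes I :: "'k::field mpoly set"
  assumes v: "v \<in> V" and IP: "I \<subseteq> point_ideal V v"
    and sq: "\<And>w. w \<in> V \<Longrightarrow> w \<noteq> v \<Longrightarrow> var w * var w \<in> I"
  shows "support V I = {point_ideal V v}"
proof (intro equalityI subsetI)
  fix P :: "'k mpoly set" assume "P \<in> {point_ideal V v}"
  then have P: "P = point_ideal V v" by simp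
  have "(var v :: 'k mpoly) \<notin> point_ideal V v"
    by (auto simp: point_ideal_def var_def intro!: exI[of _ 1])
  then show "P \<in> support V I"
    unfolding support_def P
    by (intro CollectI conjI homogeneous_point_ideal primeideal_point_ideal IP bexI[OF _ v])
next
  fix P assume "P \<in> support V I"
  then have hom: "homogeneous_ideal V P" and prime: "primeideal P (poly_ring V)" and "I \<subseteq> P"
    and nonempty: "\<exists>w\<in>V. var w \<notin> P"
    by (auto simp: support_def)
  have idP: "ideal P (poly_ring V)"
    using hom by (simp add: homogeneous_ideal_def)
  have var_P: "var w \<in> P" if "w \<in> V" "w \<noteq> v" for w
    using primeideal.I_prime[OF prime var_in_carrier[OF that(1)] var_in_carrier[OF that(1)]]
      sq[OF that] \<open>I \<subseteq> P\<close> by auto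
  then have vP: "var v \<notin> P" using nonempty by blast
  have sub: "point_ideal V v \<subseteq> P"
  proof
    fix f :: "'k mpoly" assume f: "f \<in> point_ideal V v"
    have "single a (lookup f a) \<in> P" if a: "a \<in> keys f" for a
    proof -
      have aV: "keys a \<subseteq> V" using f a by (auto simp: point_ideal_def in_carrier_iff)
      have "a \<noteq> single v k" for k using f a by (auto simp: point_ideal_def in_keys_iff)
      then have "\<not> keys a \<subseteq> {v}"
        by (metis (no_types, lifting) in_keys_iff insertE empty_iff lookup_single_eq lookup_single_not_eq
            poly_mapping_eqI subset_iff)
      then obtain w where w: "w \<in> keys a" "w \<noteq> v" by blast
      obtain b where b: "a = single w 1 + b" using monom_decompose[OF w(1)] by blast
      have "single (single w 1) 1 \<in> P" using var_P[of w] w aV by (auto simp: var_def)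
      then show ?thesis
        unfolding b by (rule ideal_monomial_dvd[OF idP]) (use aV b in \<open>auto simp: keys_plus_monom\<close>)
    qed
    then show "f \<in> P"
      by (subst mpoly_expand) (rule ideal_sum[OF idP])
  qed
  have "{f \<in> P. \<exists>d. homogeneous d f} \<subseteq> point_ideal V v"
  proof
    fix f assume "f \<in> {f \<in> P. \<exists>d. homogeneous d f}"
    then obtain d where f: "f \<in> P" "homogeneous d f" by blast
    have fS: "f \<in> carrier (poly_ring V)" using f(1) ideal_subset[OF idP] by blast
    have other: "lookup f (single v k) = 0" if "k \<noteq> d" for k
      using f(2) that by (force simp: homogeneous_def in_keys_iff)
    have "lookup f (single v d) = 0"
    proof (rule ccontr)
      let ?c = "lookup f (single v d)"
      assume c: "?c \<noteq> 0"
      have S: "single (single v d) ?c \<in> carrier (poly_ring V)"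
        using v by (intro single_in_carrier) (auto split: if_splits)
      \<comment> \<open>Without its pure power \<open>f\<close> is in the point ideal, hence in
        \<open>P\<close>; so the pure power lies in \<open>P\<close> too.\<close>
      have "f - single (single v d) ?c \<in> carrier (poly_ring V)"
        by (rule ideal_diff[OF ideal_carrier fS S])
      moreover have "lookup (f - single (single v d) ?c) (single v k) = 0" for k
        using other[of k] by (auto simp: lookup_minus lookup_single when_def single_inject)
      ultimately have "f - single (single v d) ?c \<in> P"
        using sub by (auto simp: point_ideal_def)
      then have "f - (f - single (single v d) ?c) \<in> P"
        by (rule ideal_diff[OF idP f(1)])
      then have "scalar_mult (1 / ?c) (single (single v d) ?c) \<in> P"
        by (intro ideal_scalar_mult[OF idP]) simp
      then have "single (single v d) 1 \<in> P"
        using c by (simp add: scalar_mult_def mult_single)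
      then show False
        using prime_contains_power[OF prime v] vP by blast
    qed
    then have "lookup f (single v k) = 0" for k
      using other by (cases "k = d") simp_all
    then show "f \<in> point_ideal V v"
      using fS by (simp add: point_ideal_def)
  qed
  then have "Idl\<^bsub>poly_ring V\<^esub> {f \<in> P. \<exists>d. homogeneous d f} \<subseteq> point_ideal V v"
    by (rule genideal_least[OF ideal_point_ideal])
  then have "P \<subseteq> point_ideal V v"
    using hom by (simp add: homogeneous_ideal_def)
  then show "P \<in> {point_ideal V v}" using sub by blast
qed

text \<open>Completed by a perfect matching of all vertices, the functional for exponent
  \<open>k\<close> reads off the coefficient of the \<open>k\<close>-th power of the loop.\<close>

lemma hafnian_system_subset_point_ideal:
  "hafnian_system n UNIV \<subseteq> (point_ideal (sym_vars n) (1, 1) :: 'k::field mpoly set)"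
proof
  fix f :: "'k mpoly" assume f: "f \<in> hafnian_system n UNIV"
  obtain p where p: "keys p \<subseteq> {(i, j). i \<in> {1..2 * n} \<and> j \<in> {1..2 * n} \<and> i < j}"
    "\<And>i. vdeg p i = of_bool (i \<in> {1..2 * n})"
    using matching_exists[of "{1..2 * n}" n] by auto
  have pV: "keys p \<subseteq> sym_vars n" using p(1) by (fastforce simp: sym_vars_def)
  have p0: "lookup p (1, 1) = 0"
    using p(1) by (auto simp: not_in_keys_iff_lookup_eq_zero[symmetric])
  have "lookup f (single (1, 1) k) = 0" for k
  proof -
    have "perfect n k (a + p) \<longleftrightarrow> a = single (1, 1) k" if "a \<in> keys f" for a
    proof -
      have "keys a \<subseteq> sym_vars n" using f that by (auto simp: in_hafnian_system_iff in_carrier_iff)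
      then have "perfect n k (a + p) \<longleftrightarrow> lookup a (1, 1) = k \<and> (\<forall>i. vdeg a i = 0)"
        using pV unfolding perfect_add p0 p(2) by simp
      also have "\<dots> \<longleftrightarrow> a = single (1, 1) k"
        using vdeg_eq_0_monom[of a] by (auto simp: vdeg_single simp del: One_nat_def)
      finally show ?thesis .
    qed
    then have "pairing f (\<lambda>a. of_bool (perfect n k (a + p))) = (\<Sum>a\<in>keys f. if a = single (1, 1) k then lookup f a else 0)"
      unfolding pairing_def by (intro sum.cong) auto
    also have "\<dots> = lookup f (single (1, 1) k)"
      by (simp add: in_keys_iff)
    finally show ?thesis using f by (simp add: in_hafnian_system_iff)
  qed
  then show "f \<in> point_ideal (sym_vars n) (1, 1)"
    using f by (simp add: point_ideal_def in_hafnian_system_iff)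
qed

text \<open>Multiplication by the loop variable turns the functional for \<open>Suc j\<close> into
  that for \<open>j\<close>, and every exponent is allowed; so this one variable already tests
  membership.\<close>

lemma saturated_hafnian_system:
  assumes "n \<ge> 1"
  shows "saturated (sym_vars n) (hafnian_system n UNIV :: 'k::field mpoly set)"
  unfolding saturated_def
proof (intro ballI impI)
  fix f :: "'k mpoly"
  assume f: "f \<in> carrier (poly_ring (sym_vars n))"
    and "\<forall>v\<in>sym_vars n. var v * f \<in> hafnian_system n UNIV"
  moreover have v: "(1, 1) \<in> sym_vars n" using assms by (simp add: sym_vars_def)
  ultimately have vf: "var (1, 1) * f \<in> hafnian_system n UNIV" by blast
  have "perfect n (Suc j) (single (1, 1) 1 + b + m) \<longleftrightarrow> perfect n j (b + m)" for j b m
    using v unfolding add.assoc perfect_add[of n _ "single (1, 1) 1"]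
    by (simp add: perfect_def vdeg_single)
  then have "pairing f (\<lambda>a. of_bool (perfect n j (a + m)))
      = pairing (var (1, 1) * f) (\<lambda>a. of_bool (perfect n (Suc j) (a + m)))" for j m
    by (simp add: var_def pairing_single_mult)
  then show "f \<in> hafnian_system n UNIV"
    using f vf by (simp add: in_hafnian_system_iff)
qed

section \<open>Generators of the apolar ideal\<close>

text \<open>Edges are unordered while variables are ordered pairs; this lets an argument start from
  either endpoint.\<close>

abbreviation edge :: "nat \<Rightarrow> nat \<Rightarrow> nat \<times> nat" where
  "edge i j \<equiv> (min i j, max i j)"

lemma edge_in_sym_vars: "edge i j \<in> sym_vars n \<longleftrightarrow> i \<in> {1..2 * n} \<and> j \<in> {1..2 * n}"
  by (auto simp: sym_vars_def)

lemma vdeg_edge: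
  "edge i j \<noteq> (1, 1) \<Longrightarrow> vdeg (single (edge i j) k) t = k * (of_bool (i = t) + of_bool (j = t))"
  by (auto simp: vdeg_single min_def max_def)

lemma incident_edge_obtain:
  assumes "keys a \<subseteq> sym_vars n" "vdeg a i \<noteq> 0"
  obtains k b where "edge i k \<noteq> (1, 1)" "a = single (edge i k) 1 + b"
    "keys b \<subseteq> sym_vars n" "i \<in> {1..2 * n}" "k \<in> {1..2 * n}"
proof -
  obtain v where v: "v \<in> keys a" "v \<noteq> (1, 1)" "fst v = i \<or> snd v = i"
    using assms(2) by (rule vdeg_pos_obtain)
  have "fst v \<le> snd v" using v(1) assms(1) by (auto simp: sym_vars_def)
  then obtain k where k: "v = edge i k"
    using v(3) by (metis max.absorb2 max.commute min.absorb1 min.commute prod.collapse)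
  obtain b where b: "a = single v 1 + b" using monom_decompose[OF v(1)] by blast
  have "edge i k \<in> sym_vars n" using v(1) assms(1) k by blast
  with v(2) b assms(1) show thesis
    unfolding edge_in_sym_vars by (intro that[of k b]) (auto simp: k keys_plus_monom)
qed

text \<open>Let \<open>b\<close> contain the edge ij, and let \<open>a\<close> cover i by ik and j
  by jl. A quadric replaces ik, jl by ij, kl, after which the common edge ij cancels and the
  induction goes on with fewer edges.\<close>

lemma switching:
  assumes J: "ideal J (poly_ring (sym_vars n))"
    and quadric: "\<And>a b. keys a \<subseteq> sym_vars n \<Longrightarrow> keys b \<subseteq> sym_vars n \<Longrightarrow> monom_degree a = 2 \<Longrightarrow>
      monom_degree b = 2 \<Longrightarrow> lookup a (1, 1) = 0 \<Longrightarrow> lookup b (1, 1) = 0 \<Longrightarrow>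
      (\<And>i. vdeg a i = vdeg b i) \<Longrightarrow> single a 1 - single b (1 :: 'k::field) \<in> J"
    and "keys a \<subseteq> sym_vars n" "keys b \<subseteq> sym_vars n" "lookup a (1, 1) = 0" "lookup b (1, 1) = 0"
    and "\<And>i. vdeg a i = vdeg b i" and "\<And>i. vdeg a i \<le> 1"
  shows "single a 1 - single b (1 :: 'k) \<in> J"
  using assms(3-)
proof (induction "monom_degree b" arbitrary: a b)
  case 0
  then have "b = 0" by (simp add: monom_degree_eq_0_iff)
  then have "a = 0" using vdeg_eq_0_monom[of a] 0 by simp
  then show ?case using \<open>b = 0\<close> ideal_zero[OF J] by simp
next
  case (Suc d)
  have mult: "single (a + c) 1 - single (b + c) (1 :: 'k) \<in> J"
    if "single a 1 - single b (1 :: 'k) \<in> J" "keys c \<subseteq> sym_vars n" for a b c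
    using ideal_mult[OF J single_in_carrier[OF that(2)] that(1), of 1]
    by (simp add: right_diff_distrib mult_single add.commute)
  have "\<exists>i. vdeg b i \<noteq> 0"
  proof (rule ccontr)
    assume "\<not> (\<exists>i. vdeg b i \<noteq> 0)"
    then have "b = 0" using vdeg_eq_0_monom[of b] Suc.prems(4) by simp
    then show False using Suc.hyps(2) by simp
  qed
  then obtain i where i: "vdeg b i \<noteq> 0" ..
  then obtain j b' where b': "edge i j \<noteq> (1, 1)" "b = single (edge i j) 1 + b'" "keys b' \<subseteq> sym_vars n"
    and ij: "i \<in> {1..2 * n}" "j \<in> {1..2 * n}"
    using incident_edge_obtain[OF Suc.prems(2)] by metis
  have vb': "vdeg b t = of_bool (i = t) + of_bool (j = t) + vdeg b' t" for t
    by (simp add: b'(2) vdeg_add vdeg_edge[OF b'(1)])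
  have vb_le: "vdeg b t \<le> 1" for t
    using Suc.prems(5,6)[of t] by simp
  have ij_ne: "i \<noteq> j" and "vdeg b j = 1"
    using vb'[of i] vb_le[of i] vb'[of j] vb_le[of j] by auto
  have db': "d = monom_degree b'" and lb': "lookup b' (1, 1) = 0"
    using Suc.hyps(2) Suc.prems(4) by (auto simp: b'(2) monom_degree_add lookup_add)
  have "vdeg a i \<noteq> 0" using Suc.prems(5) i by simp
  then obtain k a' where a': "edge i k \<noteq> (1, 1)" "a = single (edge i k) 1 + a'" "keys a' \<subseteq> sym_vars n"
    and k: "k \<in> {1..2 * n}"
    using incident_edge_obtain[OF Suc.prems(1)] by metis
  have va': "vdeg a t = of_bool (i = t) + of_bool (k = t) + vdeg a' t" for t
    by (simp add: a'(2) vdeg_add vdeg_edge[OF a'(1)])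
  have la': "lookup a' (1, 1) = 0" using Suc.prems(3) by (simp add: a'(2) lookup_add)
  show ?case
  proof (cases "k = j")
    case True
    have "single a' 1 - single b' (1 :: 'k) \<in> J"
    proof (rule Suc.hyps(1)[OF db' a'(3) b'(3) la' lb'])
      show "vdeg a' t = vdeg b' t" for t
        using Suc.prems(5)[of t] by (simp add: va' vb' True)
      show "vdeg a' t \<le> 1" for t
        using Suc.prems(6)[of t] by (simp add: va')
    qed
    then have "single (a' + single (edge i j) 1) 1 - single (b' + single (edge i j) 1) (1 :: 'k) \<in> J"
      using ij by (intro mult) (simp_all add: edge_in_sym_vars)
    then show ?thesis by (simp add: a'(2) b'(2) True add.commute)
  next
    case False
    then have "vdeg a' j \<noteq> 0"
      using \<open>vdeg b j = 1\<close> Suc.prems(5)[of j] ij_ne by (simp add: va')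
    then obtain l a'' where a'': "edge j l \<noteq> (1, 1)" "a' = single (edge j l) 1 + a''" "keys a'' \<subseteq> sym_vars n"
      and l: "l \<in> {1..2 * n}"
      using incident_edge_obtain[OF a'(3)] by metis
    have va'': "vdeg a' t = of_bool (j = t) + of_bool (l = t) + vdeg a'' t" for t
      by (simp add: a''(2) vdeg_add vdeg_edge[OF a''(1)])
    \<comment> \<open>Otherwise this vertex would have degree 2 in \<open>a\<close>; it also keeps
      the new edge from being a loop.\<close>
    have "k \<noteq> l" using Suc.prems(6)[of k] by (auto simp: va' va'')
    then have kl: "edge k l \<noteq> (1, 1)" by (auto simp: min_def max_def split: if_splits)
    let ?c = "single (edge k l) 1 + a''"
    have la'': "lookup a'' (1, 1) = 0" using la' by (simp add: a''(2) lookup_add)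
    have c: "keys ?c \<subseteq> sym_vars n" "lookup ?c (1, 1) = 0"
      using kl k l a''(3) la'' by (auto simp: keys_plus_monom lookup_add lookup_single when_def edge_in_sym_vars
          simp del: One_nat_def)
    have vc: "vdeg ?c t = of_bool (k = t) + of_bool (l = t) + vdeg a'' t" for t
      by (simp add: vdeg_add vdeg_edge[OF kl])
    have "single ?c 1 - single b' (1 :: 'k) \<in> J"
    proof (rule Suc.hyps(1)[OF db' c(1) b'(3) c(2) lb'])
      show "vdeg ?c t = vdeg b' t" for t
        using vc[of t] Suc.prems(5)[of t] by (simp add: va' va'' vb')
      show "vdeg ?c t \<le> 1" for t
        using vc[of t] Suc.prems(6)[of t] by (simp add: va' va'')
    qed
    then have 1: "single (?c + single (edge i j) 1) 1 - single (b' + single (edge i j) 1) (1 :: 'k) \<in> J"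
      using ij by (intro mult) (simp_all add: edge_in_sym_vars)
    have "single (single (edge i k) 1 + single (edge j l) 1) 1
        - single (single (edge k l) 1 + single (edge i j) 1) (1 :: 'k) \<in> J"
    proof (rule quadric)
      show "keys (single (edge i k) 1 + single (edge j l) 1 :: monom) \<subseteq> sym_vars n"
        "keys (single (edge k l) 1 + single (edge i j) 1 :: monom) \<subseteq> sym_vars n"
        using ij k l by (simp_all add: keys_plus_monom edge_in_sym_vars)
      show "lookup (single (edge i k) 1 + single (edge j l) 1 :: monom) (1, 1) = 0"
        "lookup (single (edge k l) 1 + single (edge i j) 1 :: monom) (1, 1) = 0"
        using a'(1) a''(1) kl b'(1) by (simp_all add: lookup_add lookup_single when_def del: One_nat_def)
      show "vdeg (single (edge i k) 1 + single (edge j l) 1) t = vdeg (single (edge k l) 1 + single (edge i j) 1) t" for t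
        by (simp add: vdeg_add vdeg_edge[OF a'(1)] vdeg_edge[OF a''(1)] vdeg_edge[OF kl] vdeg_edge[OF b'(1)])
    qed (simp_all add: monom_degree_add)
    then have 2: "single (single (edge i k) 1 + single (edge j l) 1 + a'') 1
        - single (single (edge k l) 1 + single (edge i j) 1 + a'') (1 :: 'k) \<in> J"
      using a''(3) by (rule mult)
    have "single a 1 - single b (1 :: 'k)
      = (single (single (edge i k) 1 + single (edge j l) 1 + a'') 1
        - single (single (edge k l) 1 + single (edge i j) 1 + a'') 1)
        + (single (?c + single (edge i j) 1) 1 - single (b' + single (edge i j) 1) 1)"
      by (simp add: a'(2) a''(2) b'(2) add_ac)
    then show ?thesis using ideal_add[OF J 2 1] by simp
  qed
qed

text \<open>Modulo the generators a monomial with a loop or a repeated vertex vanishes, and any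
  other depends only on its vertex set. What remains of an apolar element is one coefficient sum per
  vertex set, and these sums are zero.\<close>

lemma apolar_hafnian_generated:
  assumes n: "n \<ge> 1"
  shows "generated_in_degree_modulo (sym_vars n) (diagonal_vars n) 2 (hafnian_system n {0} :: 'k::field mpoly set)"
  unfolding generated_in_degree_modulo_def
proof
  let ?V = "sym_vars n"
  let ?A = "hafnian_system n {0} :: 'k mpoly set"
  let ?G = "diagonal_vars n \<union> {\<Phi> \<in> ?A. homogeneous 2 \<Phi>}"
  let ?J = "Idl\<^bsub>poly_ring ?V\<^esub> ?G"
  have diag: "diagonal_vars n \<subseteq> ?A"
  proof
    fix f :: "'k mpoly" assume "f \<in> diagonal_vars n"
    then obtain i where i: "i \<in> {1..2 * n}" "f = var (i, i)" by (auto simp: diagonal_vars_def)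
    have keys: "keys (single (i, i) 1 :: monom) \<subseteq> ?V" using i(1) by (simp add: sym_vars_def)
    show "f \<in> ?A"
    proof (cases "i = 1")
      case True
      then show ?thesis
        using keys unfolding i(2) var_def by (intro single_in_hafnian_system) (auto simp: perfect_add)
    next
      case False
      then show ?thesis
        using keys unfolding i(2) var_def
        by (intro single_in_hafnian_system_vdeg[of _ _ i]) (auto simp: vdeg_single)
    qed
  qed
  then have GA: "?G \<subseteq> ?A" by auto
  then have GS: "?G \<subseteq> carrier (poly_ring ?V)"
    using ideal_subset[OF ideal_hafnian_system] by blast
  have J: "ideal ?J (poly_ring ?V)" and GJ: "?G \<subseteq> ?J"
    by (rule ideal_genideal[OF GS], rule genideal_superset[OF GS])
  show "?J \<subseteq> ?A"
    by (rule genideal_least[OF ideal_hafnian_system GA])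
  have bad: "single a c \<in> ?J"
    if aV: "keys a \<subseteq> ?V" and bad: "lookup a (1, 1) \<noteq> 0 \<or> vdeg a i \<ge> 2" for a c i
  proof -
    have diag_dvd: "single a c \<in> ?J" if "a = single (j, j) 1 + b" "j \<in> {1..2 * n}" for j b
    proof -
      have "single (single (j, j) 1) 1 \<in> ?J"
        using GJ that(2) by (auto simp: diagonal_vars_def var_def)
      then show ?thesis
        unfolding that(1) by (rule ideal_monomial_dvd[OF J]) (use aV that(1) in \<open>simp add: keys_plus_monom\<close>)
    qed
    show ?thesis
    proof (cases "lookup a (1, 1) = 0")
      case False
      then have "(1, 1) \<in> keys a" by (simp add: in_keys_iff)
      from monom_decompose[OF this] obtain b where "a = single (1, 1) 1 + b" ..
      then show ?thesis by (rule diag_dvd) (use n in simp)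
    next
      case True
      then have v2: "vdeg a i \<ge> 2" using bad by simp
      then have "vdeg a i \<noteq> 0" by simp
      with aV obtain k b where b: "edge i k \<noteq> (1, 1)" "a = single (edge i k) 1 + b" "keys b \<subseteq> ?V"
        "i \<in> {1..2 * n}" "k \<in> {1..2 * n}"
        by (rule incident_edge_obtain)
      show ?thesis
      proof (cases "k = i")
        case True
        then show ?thesis using b by (intro diag_dvd[of i b]) simp_all
      next
        case False
        then have "vdeg b i \<noteq> 0"
          using v2 by (simp add: b(2) vdeg_add vdeg_edge[OF b(1)])
        with b(3) obtain l c' where c': "edge i l \<noteq> (1, 1)" "b = single (edge i l) 1 + c'" "keys c' \<subseteq> ?V"
          "i \<in> {1..2 * n}" "l \<in> {1..2 * n}"
          by (rule incident_edge_obtain)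
        \<comment> \<open>Two edges at \<open>i\<close>, possibly equal, form an apolar quadric
          dividing the monomial.\<close>
        let ?q = "single (edge i k) 1 + single (edge i l) 1 :: monom"
        have "keys ?q \<subseteq> ?V"
          using b(4,5) c'(5) by (simp add: keys_plus_monom edge_in_sym_vars)
        moreover have "vdeg ?q i \<ge> 2"
          by (simp add: vdeg_add vdeg_edge[OF b(1)] vdeg_edge[OF c'(1)])
        ultimately have "single ?q 1 \<in> ?A"
          by (rule single_in_hafnian_system_vdeg)
        moreover have "homogeneous 2 (single ?q (1 :: 'k))"
          by (rule homogeneous_single) (simp add: monom_degree_add)
        ultimately have "single ?q 1 \<in> ?J" using GJ by blast
        then have "single (?q + c') c \<in> ?J"
          by (rule ideal_monomial_dvd[OF J _ c'(3)])
        then show ?thesis by (simp add: b(2) c'(2) add.assoc)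
      qed
    qed
  qed
  show "?A \<subseteq> ?J"
  proof
    fix f assume f: "f \<in> ?A"
    have fV: "keys a \<subseteq> ?V" if "a \<in> keys f" for a
      using f that by (auto simp: in_hafnian_system_iff in_carrier_iff)
    define good where "good = {a \<in> keys f. lookup a (1, 1) = 0 \<and> (\<forall>i. vdeg a i \<le> 1)}"
    define U where "U a = {i. vdeg a i = 1}" for a
    \<comment> \<open>Representatives are taken among the monomials of \<open>f\<close>, so they are
      matchings in the variables of the ring.\<close>
    define r where "r u = (SOME a. a \<in> good \<and> U a = u)" for u
    have vU: "vdeg a i = of_bool (i \<in> U a)" if "a \<in> good" for a i
    proof -
      have "vdeg a i \<le> 1" using that by (simp add: good_def)
      then show ?thesis by (auto simp: U_def)
    qed
    have r: "r (U a) \<in> good" "U (r (U a)) = U a" if "a \<in> good" for a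
      using someI[of "\<lambda>b. b \<in> good \<and> U b = U a" a] that by (auto simp: r_def)
    have fin: "finite good" by (simp add: good_def)
    have classes: "(\<Sum>a\<in>{a\<in>good. U a = u}. lookup f a) = 0" if u: "u \<in> U ` good" for u
    proof -
      obtain a0 where a0: "a0 \<in> good" "u = U a0" using u by blast
      have "keys a0 \<subseteq> ?V" using a0(1) fV by (simp add: good_def)
      have "u \<subseteq> {1..2 * n}"
        using vdeg_outside[OF \<open>keys a0 \<subseteq> ?V\<close>] unfolding a0(2) U_def by force
      moreover have "card u + 2 * lookup a0 (1, 1) = 2 * monom_degree a0"
        by (rule vdeg_indicator_card[OF \<open>keys a0 \<subseteq> ?V\<close> \<open>u \<subseteq> {1..2 * n}\<close>]) (simp add: a0(2) vU[OF a0(1)])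
      then have "even (card u)"
        by (metis dvd_triv_left even_add)
      moreover have "{a\<in>good. U a = u} = {a\<in>keys f. lookup a (1, 1) = 0 \<and> (\<forall>i. vdeg a i = of_bool (i \<in> u))}"
      proof (intro equalityI subsetI)
        fix a assume "a \<in> {a\<in>good. U a = u}"
        then show "a \<in> {a\<in>keys f. lookup a (1, 1) = 0 \<and> (\<forall>i. vdeg a i = of_bool (i \<in> u))}"
          using vU[of a] by (auto simp: good_def)
      next
        fix a assume "a \<in> {a\<in>keys f. lookup a (1, 1) = 0 \<and> (\<forall>i. vdeg a i = of_bool (i \<in> u))}"
        then show "a \<in> {a\<in>good. U a = u}"
          by (auto simp: good_def U_def split: if_splits)
      qed
      ultimately show ?thesis
        using f by (subst (asm) in_hafnian_system_iff_class_sums) auto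
    qed
    \<comment> \<open>The representatives, weighted by the coefficients of \<open>f\<close>, cancel
      class by class, so subtracting them does not change \<open>f\<close>.\<close>
    have "(\<Sum>a\<in>good. single (r (U a)) (lookup f a)) = (\<Sum>u\<in>U ` good. \<Sum>a\<in>{a\<in>good. U a = u}. single (r (U a)) (lookup f a))"
      by (rule sum.image_gen[OF fin])
    also have "\<dots> = (\<Sum>u\<in>U ` good. single (r u) (\<Sum>a\<in>{a\<in>good. U a = u}. lookup f a))"
    proof (rule sum.cong[OF refl])
      fix u
      have "single c (sum h A) = (\<Sum>a\<in>A. single c (h a))" if "finite A" for c :: monom and h :: "monom \<Rightarrow> 'k" and A
        using that by (induction A rule: finite_induct) (simp_all add: single_add)
      then show "(\<Sum>a\<in>{a\<in>good. U a = u}. single (r (U a)) (lookup f a)) = single (r u) (\<Sum>a\<in>{a\<in>good. U a = u}. lookup f a)"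
        using fin by simp
    qed
    also have "\<dots> = 0" using classes by simp
    finally have reps: "(\<Sum>a\<in>good. single (r (U a)) (lookup f a)) = 0" .
    have diff: "single a (lookup f a) - single (r (U a)) (lookup f a) \<in> ?J" if a: "a \<in> good" for a
    proof -
      have "single a 1 - single (r (U a)) (1 :: 'k) \<in> ?J"
      proof (rule switching[OF J])
        fix a b :: monom
        assume ab: "keys a \<subseteq> ?V" "keys b \<subseteq> ?V" "monom_degree a = 2" "monom_degree b = 2"
          "lookup a (1, 1) = 0" "lookup b (1, 1) = 0" "\<And>i. vdeg a i = vdeg b i"
        have "pairing (single a 1 - single b (1 :: 'k)) \<theta> = \<theta> a - \<theta> b" for \<theta>
          using pairing_add[of "single a 1 - single b (1 :: 'k)" "single b 1" \<theta>] by simp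
        moreover have "single a 1 - single b (1 :: 'k) \<in> carrier (poly_ring ?V)"
          by (intro ideal_diff[OF ideal_carrier] single_in_carrier ab)
        ultimately have "single a 1 - single b (1 :: 'k) \<in> ?A"
          using ab by (simp add: in_hafnian_system_iff perfect_add)
        moreover have "homogeneous 2 (single a 1 - single b (1 :: 'k))"
          using homogeneous_add[OF homogeneous_single[OF ab(3), of 1] homogeneous_single[OF ab(4), of "- 1 :: 'k"]]
          by (simp add: single_uminus)
        ultimately show "single a 1 - single b (1 :: 'k) \<in> ?J" using GJ by blast
      qed (use a r[OF a] fV vU[OF a] vU[OF r(1)[OF a]] in \<open>auto simp: good_def\<close>)
      then have "scalar_mult (lookup f a) (single a 1 - single (r (U a)) 1) \<in> ?J"
        by (rule ideal_scalar_mult[OF J])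
      then show ?thesis
        by (simp add: scalar_mult_def right_diff_distrib mult_single)
    qed
    have "single a (lookup f a) \<in> ?J" if a: "a \<in> keys f - good" for a
    proof -
      obtain i where "lookup a (1, 1) \<noteq> 0 \<or> \<not> vdeg a i \<le> 1"
        using a unfolding good_def by blast
      then have "lookup a (1, 1) \<noteq> 0 \<or> vdeg a i \<ge> 2" by linarith
      then show ?thesis using bad[OF fV] a by blast
    qed
    then have "(\<Sum>a\<in>keys f - good. single a (lookup f a)) + (\<Sum>a\<in>good. single a (lookup f a) - single (r (U a)) (lookup f a)) \<in> ?J"
      using diff by (intro ideal_add[OF J] ideal_sum[OF J])
    also have "(\<Sum>a\<in>keys f - good. single a (lookup f a)) + (\<Sum>a\<in>good. single a (lookup f a) - single (r (U a)) (lookup f a)) = f"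
      using sum.subset_diff[of good "keys f" "\<lambda>a. single a (lookup f a)"] mpoly_expand[of f] reps
      by (simp add: sum_subtractf good_def)
    finally show "f \<in> ?J" .
  qed
qed

theorem theorem4p14:
  fixes n :: nat
  assumes char: "CHAR('k::field) = 0 \<or> CHAR('k) > 2"
    and n: "n \<ge> 1"
  shows "generated_in_degree_modulo (sym_vars n) (diagonal_vars n) 2
           (apolar_ideal (sym_vars n) (hafnian n :: 'k mpoly))
         \<and> 2 ^ (2 * n - 2) \<le> cactus_rank (sym_vars n) (hafnian n :: 'k mpoly)
         \<and> cactus_rank (sym_vars n) (hafnian n :: 'k mpoly) \<le> 2 ^ (2 * n - 1)"
proof -
  let ?V = "sym_vars n"
  let ?A = "hafnian_system n {0} :: 'k mpoly set"
  let ?I = "hafnian_system n UNIV :: 'k mpoly set"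
  let ?cactus = "\<lambda>d. \<exists>I. closed_subscheme_ideal ?V I \<and> zero_dimensional ?V I \<and> has_degree ?V I d \<and> I \<subseteq> ?A"
  have rank: "cactus_rank ?V (hafnian n :: 'k mpoly) = (LEAST d. ?cactus d)"
    by (simp add: cactus_rank_def apolar_ideal_hafnian)
  have upper: "?cactus (2 ^ (2 * n - 1))"
  proof (intro exI conjI)
    show "closed_subscheme_ideal ?V ?I"
      by (simp add: closed_subscheme_ideal_def homogeneous_hafnian_system saturated_hafnian_system[OF n])
    have "support ?V ?I = {point_ideal ?V (1, 1)}"
      using n by (intro support_eq_point_ideal hafnian_system_subset_point_ideal sq_in_hafnian_system)
        (auto simp: sym_vars_def)
    then show "zero_dimensional ?V ?I" by (simp add: zero_dimensional_def)
    show "has_degree ?V ?I (2 ^ (2 * n - 1))" by (rule has_degree_hafnian_system[OF n])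
    show "?I \<subseteq> ?A" by (auto simp: in_hafnian_system_iff)
  qed
  have lower: "2 ^ (2 * n - 2) \<le> d" if cactus: "?cactus d" for d
  proof -
    obtain I where "closed_subscheme_ideal ?V I" "has_degree ?V I d" "I \<subseteq> ?A"
      using cactus by blast
    \<comment> \<open>Even subsets have size at most \<open>2 * n\<close>, so the degrees up to
      \<open>n\<close> carry the whole length of the apolar quotient.\<close>
    then have "(\<Sum>t\<le>n. hilbert_function ?V ?A t) \<le> 2 * d"
      by (intro length_le_twice_degree[OF finite_sym_vars _ _ ideal_hafnian_system] sq_in_hafnian_system) auto
    then have "2 ^ (2 * n - 1) \<le> 2 * d"
      by (simp add: length_apolar_hafnian[OF n])
    moreover have "2 * n - 1 = Suc (2 * n - 2)" using n by simp
    ultimately show ?thesis by simp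
  qed
  show ?thesis
    unfolding rank apolar_ideal_hafnian
    using apolar_hafnian_generated[OF n] lower[OF LeastI[of ?cactus, OF upper]] Least_le[of ?cactus, OF upper]
    by blast
qed

end
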